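(* For every integer $b\ge 2$, there exist constants $\alpha=\alpha_b$, $\gamma=\gamma_b$ and $\kappa=\kappa_b<1$ such that the number $q_b(m)$ of compositions of $1$ into $n=(b-1)m+1$ powers of $b$, which is also equal to the maximum number $\mathcal{W}_b(1,n)$ of representations of a power of $b$ as an ordered sum of $n$ powers of $b$, satisfies $$\frac{\mathcal{W}_b(1,n)}{n!} = \frac{q_b(m)}{n!} = \alpha\,\gamma^m\bigl(1+O(\kappa^m)\bigr) \quad (m\to\infty).$$ More generally, for every fixed integer $s\ge 1$, the maximum number $\mathcal{W}_b(s,n)$ of representations of a positive integer with $b$-ary sum of digits $s$ as an ordered sum of $n=(b-1)m+s$ powers of $b$ is asymptotically given by $$\frac{\mathcal{W}_b(s,n)}{n!} = P_{b,s}(m)\,\gamma^m\bigl(1+O(\kappa^m)\bigr) \quad (m\to\infty),$$ where $P_{b,s}(m)$ is a polynomial in $m$ with leading term $\alpha^s m^{s-1}/(s-1)!$.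
   Context: $\mathbb{N}_0$ denotes the nonnegative integers. For an integer $b\ge2$ and positive integers $\ell,n$, let $$\mathcal{U}_b(\ell,n)=\#\{(a_1,\ldots,a_n)\in\mathbb{N}_0^n : b^{a_1}+\cdots+b^{a_n}=\ell\}.$$ For a positive integer $s$, $\mathcal{W}_b(s,n)$ is the maximum of $\mathcal{U}_b(\ell,n)$ over all positive integers $\ell$ whose $b$-ary sum of digits equals $s$. For $m\ge 0$, $q_b(m)$ denotes the number of $n$-tuples $(k_1,\ldots,k_n)$ of nonnegative integers, $n=(b-1)m+1$, with $b^{-k_1}+b^{-k_2}+\cdots+b^{-k_n}=1$ (such a tuple is called a composition of $1$ into $n$ powers of $b$). The implied constants in the $O$-terms may depend on $b$ and $s$. *)

theory Defs
  imports Complex_Main "HOL-Library.Landau_Symbols" "HOL-Computational_Algebra.Polynomial"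
begin

definition power_reps :: "nat \<Rightarrow> nat \<Rightarrow> nat \<Rightarrow> nat list set" where
  "power_reps b l n = {as. length as = n \<and> (\<Sum>a\<leftarrow>as. b ^ a) = l}"

definition U :: "nat \<Rightarrow> nat \<Rightarrow> nat \<Rightarrow> nat" where
  "U b l n = card (power_reps b l n)"

text \<open>For \<open>b \<ge> 2\<close> the base-\<open>b\<close> digit of \<open>l\<close> at position \<open>i\<close> is \<open>l div b ^ i mod b\<close>. It
  vanishes for \<open>i \<ge> l\<close> because \<open>l < b ^ l\<close>.\<close>

definition digit_sum :: "nat \<Rightarrow> nat \<Rightarrow> nat" where
  "digit_sum b l = (\<Sum>i<l. l div b ^ i mod b)"

text \<open>The maximum ranges over infinitely many \<open>l\<close>; the lemmas \<open>finite_U_image\<close> and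
  \<open>digit_sum_set_nonempty\<close> below show that \<open>Max\<close> is applied to a finite nonempty set of values.\<close>

definition W :: "nat \<Rightarrow> nat \<Rightarrow> nat \<Rightarrow> nat" where
  "W b s n = Max ((\<lambda>l. U b l n) ` {l. l > 0 \<and> digit_sum b l = s})"

definition unit_compositions :: "nat \<Rightarrow> nat \<Rightarrow> nat list set" where
  "unit_compositions b n = {ks. length ks = n \<and> (\<Sum>k\<leftarrow>ks. 1 / real b ^ k) = 1}"

definition q :: "nat \<Rightarrow> nat \<Rightarrow> nat" where
  "q b m = card (unit_compositions b ((b - 1) * m + 1))"

lemma finite_power_reps:
  assumes "b \<ge> 2"
  shows "finite (power_reps b l n)"
proof (rule finite_subset)
  show "power_reps b l n \<subseteq> {as. set as \<subseteq> {..l} \<and> length as = n}"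
  proof (clarsimp simp: power_reps_def)
    fix as :: "nat list" and x assume "x \<in> set as"
    then have "b ^ x \<le> (\<Sum>a\<leftarrow>as. b ^ a)"
      by (intro member_le_sum_list) auto
    moreover have "x < b ^ x"
      using assms by (intro power_gt_expt) auto
    ultimately show "x \<le> (\<Sum>a\<leftarrow>as. b ^ a)" by linarith
  qed
  show "finite {as. set as \<subseteq> {..l} \<and> length as = n}"
    by (rule finite_lists_length_eq) simp
qed

lemma near_powers_subset:
  assumes "b \<ge> (2::nat)" "b ^ m \<le> l" "l \<le> n * b ^ m" "b ^ a \<le> l" "m \<le> a"
  shows "a < m + n"
proof -
  have "b ^ (a - m) * b ^ m = b ^ a"
    using assms(5) by (simp only: power_add [symmetric] le_add_diff_inverse2)
  then have "b ^ (a - m) * b ^ m \<le> n * b ^ m"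
    using assms(3,4) by linarith
  moreover have "0 < b ^ m" using assms(1) by simp
  ultimately have "b ^ (a - m) \<le> n" by (simp only: mult_le_cancel2)
  moreover have "a - m < b ^ (a - m)" using assms(1) by (intro power_gt_expt) simp
  ultimately show ?thesis by linarith
qed

lemma card_near_powers:
  assumes b: "b \<ge> (2::nat)"
  shows "finite {a. b ^ a \<le> l \<and> l \<le> n * b ^ a} \<and> card {a. b ^ a \<le> l \<and> l \<le> n * b ^ a} \<le> n"
proof (cases "{a. b ^ a \<le> l \<and> l \<le> n * b ^ a} = {}")
  case True
  show ?thesis unfolding True by simp
next
  case False
  define A where "A = {a. b ^ a \<le> l \<and> l \<le> n * b ^ a}"
  define m where "m = (LEAST a. a \<in> A)"
  have "\<exists>a. a \<in> A" using False unfolding A_def by blast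
  then have "m \<in> A" unfolding m_def by (rule LeastI_ex)
  then have m: "b ^ m \<le> l" "l \<le> n * b ^ m" unfolding A_def by blast+
  have "A \<subseteq> {m..<m+n}"
  proof
    fix a assume a: "a \<in> A"
    have le: "m \<le> a" unfolding m_def using a by (rule Least_le)
    have "b ^ a \<le> l" using a unfolding A_def by blast
    from near_powers_subset[OF b m this le] show "a \<in> {m..<m+n}" using le by simp
  qed
  from card_mono[OF _ this] finite_subset[OF this] have "finite A \<and> card A \<le> n" by simp
  then show ?thesis unfolding A_def .
qed

lemma U_bounded:
  assumes "b \<ge> 2"
  shows "U b l n \<le> (fact n)\<^sup>2"
proof (induction n arbitrary: l)
  case 0
  have "power_reps b l 0 \<subseteq> {[]}" by (auto simp: power_reps_def)
  from card_mono[OF _ this] show ?case by (simp add: U_def)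
next
  case (Suc n)
  let ?A = "{a. b ^ a \<le> l \<and> l \<le> Suc n * b ^ a}"
  let ?f = "\<lambda>(i, a, xs). take i xs @ a # drop i xs"
  let ?S = "{..n} \<times> (SIGMA a:?A. power_reps b (l - b ^ a) n)"
  have A: "finite ?A" "card ?A \<le> Suc n" using card_near_powers[OF assms] by blast+
  have "power_reps b l (Suc n) \<subseteq> ?f ` ?S"
  proof
    fix as assume "as \<in> power_reps b l (Suc n)"
    then have len: "length as = Suc n" and sum: "(\<Sum>a\<leftarrow>as. b ^ a) = l"
      by (auto simp: power_reps_def)
    define a where "a = Max (set as)"
    have ne: "as \<noteq> []" using len by auto
    then have "a \<in> set as" by (simp add: a_def)
    then obtain ys zs where as: "as = ys @ a # zs" by (meson split_list)
    have "(\<Sum>x\<leftarrow>as. b ^ x) \<le> (\<Sum>x\<leftarrow>as. b ^ a)"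
      using assms by (intro sum_list_mono power_increasing) (auto simp: a_def)
    then have "l \<le> Suc n * b ^ a" using len sum by (simp add: sum_list_triv)
    moreover have "b ^ a \<le> l" using sum as by auto
    moreover have "ys @ zs \<in> power_reps b (l - b ^ a) n"
      using sum len as by (auto simp: power_reps_def)
    moreover have "length ys \<le> n" using len as by simp
    ultimately have "(length ys, a, ys @ zs) \<in> ?S" by auto
    moreover have "as = ?f (length ys, a, ys @ zs)" using as by simp
    ultimately show "as \<in> ?f ` ?S" by blast
  qed
  moreover have fin: "finite ?S" using A finite_power_reps[OF assms] by auto
  ultimately have "U b l (Suc n) \<le> card ?S"
    unfolding U_def using surj_card_le[of ?S _ ?f] by (simp only:)
  also have "\<dots> = Suc n * (\<Sum>a\<in>?A. U b (l - b ^ a) n)"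
    using A finite_power_reps[OF assms] by (simp add: card_cartesian_product U_def)
  also have "\<dots> \<le> Suc n * (\<Sum>a\<in>?A. (fact n)\<^sup>2)"
    using Suc.IH by (intro mult_left_mono sum_mono) auto
  also have "\<dots> \<le> Suc n * (Suc n * (fact n)\<^sup>2)"
    using A by (simp del: mult_Suc)
  also have "\<dots> = (fact (Suc n))\<^sup>2"
    by (simp add: power2_eq_square algebra_simps)
  finally show ?case .
qed

lemma finite_U_image:
  assumes "b \<ge> 2"
  shows "finite ((\<lambda>l. U b l n) ` {l. l > 0 \<and> digit_sum b l = s})"
proof (rule finite_subset)
  show "(\<lambda>l. U b l n) ` {l. l > 0 \<and> digit_sum b l = s} \<subseteq> {..(fact n)\<^sup>2}"
    by (intro image_subsetI) (simp only: atMost_iff U_bounded[OF assms])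
qed (rule finite_atMost)

lemma digit_sum_upper:
  assumes "b \<ge> 2" "N \<ge> l"
  shows "digit_sum b l = (\<Sum>i<N. l div b ^ i mod b)"
  unfolding digit_sum_def
proof (rule sum.mono_neutral_left)
  have "l < b ^ i" if "i \<ge> l" for i
    using power_gt_expt[of b i] assms that by linarith
  then show "\<forall>i\<in>{..<N} - {..<l}. l div b ^ i mod b = 0" by auto
qed (use assms in auto)

lemma digit_sum_rec:
  assumes "b \<ge> 2" "c < b"
  shows "digit_sum b (b * l + c) = c + digit_sum b l"
proof -
  let ?N = "b * l + c"
  have "l \<le> ?N" using assms by (simp add: trans_le_add1)
  then have "digit_sum b l = (\<Sum>i<?N. l div b ^ i mod b)"
    using assms digit_sum_upper by blast
  moreover have "digit_sum b ?N = (\<Sum>i<Suc ?N. ?N div b ^ i mod b)"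
    using assms digit_sum_upper[of b ?N "Suc ?N"] by simp
  ultimately show ?thesis
    using assms by (simp only: sum.lessThan_Suc_shift) (simp add: div_mult2_eq)
qed

lemma digit_sum_set_nonempty:
  assumes "b \<ge> 2" "s \<ge> 1"
  shows "{l. l > 0 \<and> digit_sum b l = s} \<noteq> {}"
proof -
  have "\<exists>l>0. digit_sum b l = Suc t" for t
  proof (induction t)
    case 0
    have "digit_sum b (b * 0 + 1) = 1 + digit_sum b 0"
      using assms by (intro digit_sum_rec) simp_all
    then have "digit_sum b 1 = Suc 0" by (simp add: digit_sum_def [of b 0])
    then show ?case by (intro exI[of _ 1] conjI zero_less_one)
  next
    case (Suc t)
    then obtain l where l: "digit_sum b l = Suc t" by blast
    have "digit_sum b (b * l + 1) = 1 + digit_sum b l"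
      using assms by (intro digit_sum_rec) simp_all
    then have "digit_sum b (b * l + 1) = Suc (Suc t)" unfolding l by simp
    then show ?case by (intro exI[of _ "b * l + 1"] conjI) simp
  qed
  from this[of "s - 1"] show ?thesis using assms(2) by auto
qed

end

theory Submission
  imports Defs "HOL-Complex_Analysis.Complex_Analysis"
begin

unbundle no vec_syntax

text \<open>Any representation of \<open>l\<close> as a sum of powers of \<open>b\<close> can be partitioned into
  representations of the powers making up the \<open>b\<close>-ary expansion of \<open>l\<close>, and if these powers are
  far apart the partition is unique. Hence \<open>W b s n / n!\<close> is the coefficient of \<open>X ^ n\<close>
  in the \<open>s\<close>-th power of the exponential generating function of the compositions of \<open>1\<close>.

  Sorting the terms of a composition by exponent encodes it as the level profile of a \<open>b\<close>-ary tree,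
  so \<open>q b m / n!\<close> is a sum over sequences of numbers of internal nodes on the successive levels,
  weighted by products of reciprocal factorials. Cutting such a sequence at the levels with exactly
  one internal node gives a renewal equation \<open>Y = G + F Y\<close>. An explicit supersolution
  bounds the weight of the sequences avoiding such levels, so that \<open>F\<close> and \<open>G\<close> converge up to
  \<open>x = (b - 1)!\<close>, where \<open>F\<close> exceeds \<open>1\<close>. Therefore \<open>F(\<rho>) = 1\<close> for some \<open>\<rho> < x\<close>, and since \<open>F\<close>
  has nonnegative coefficients and a nonzero linear one, \<open>\<rho>\<close> is the only singularity of \<open>Y\<close> in a
  disc of radius larger than \<open>\<rho>\<close>, a simple pole. Powers of a series with one simple pole
  have coefficients that are polynomial times exponential, up to an exponentially smaller error.\<close>

section \<open>Counting by exponent functions\<close>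

text \<open>Extensional functions on an arbitrary index set replace lists, so that a subset of the
  positions can be removed without renumbering the others. The weights lie in a general monoid
  because both natural powers \<open>b ^ a\<close> and real reciprocals are needed.\<close>

definition weight_fibre :: "(nat \<Rightarrow> 'm::comm_monoid_add) \<Rightarrow> 'm \<Rightarrow> 'i set \<Rightarrow> ('i \<Rightarrow> nat) set" where
  "weight_fibre g v I = {a \<in> I \<rightarrow>\<^sub>E UNIV. (\<Sum>i\<in>I. g (a i)) = v}"

lemma card_weight_fibre:
  fixes g :: "nat \<Rightarrow> 'm::comm_monoid_add" and I :: "'i set"
  assumes "finite I"
  shows "card (weight_fibre g v I) = card {xs. length xs = card I \<and> (\<Sum>x\<leftarrow>xs. g x) = v}"
proof -
  obtain h where h: "bij_betw h {..<card I} I"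
    using ex_bij_betw_nat_finite[OF assms] by (auto simp: lessThan_atLeast0)
  then have himg: "h ` {..<card I} = I" and hinj: "inj_on h {..<card I}"
    by (auto simp: bij_betw_def)
  define k where "k = inv_into {..<card I} h"
  have kh: "k (h j) = j" if "j < card I" for j
    using that hinj by (simp add: k_def inv_into_f_f)
  have hk: "h (k i) = i" and k: "k i < card I" if "i \<in> I" for i
    using that himg inv_into_into[of i h "{..<card I}"] by (auto simp: k_def f_inv_into_f)
  let ?F = "\<lambda>a. map (a \<circ> h) [0..<card I]"
  let ?G = "\<lambda>xs. \<lambda>i\<in>I. xs ! k i"
  have sum: "(\<Sum>j<card I. g (a (h j))) = (\<Sum>i\<in>I. g (a i))" for a
    using sum.reindex_bij_betw[OF h, of "\<lambda>i. g (a i)"] .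
  have "bij_betw ?F (weight_fibre g v I) {xs. length xs = card I \<and> (\<Sum>x\<leftarrow>xs. g x) = v}"
  proof (rule bij_betw_byWitness[where f' = ?G])
    show "\<forall>a\<in>weight_fibre g v I. ?G (?F a) = a"
    proof
      fix a assume "a \<in> weight_fibre g v I"
      then have "a \<in> extensional I" by (auto simp: weight_fibre_def PiE_def)
      then show "?G (?F a) = a"
        by (intro extensionalityI[where A = I]) (auto simp: hk k)
    qed
    have hI: "h j \<in> I" if "j < card I" for j using himg that by auto
    show "\<forall>xs\<in>{xs. length xs = card I \<and> (\<Sum>x\<leftarrow>xs. g x) = v}. ?F (?G xs) = xs"
      by (auto intro!: nth_equalityI simp: kh hI)
    show "?F ` weight_fibre g v I \<subseteq> {xs. length xs = card I \<and> (\<Sum>x\<leftarrow>xs. g x) = v}"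
    proof (clarsimp simp: weight_fibre_def)
      fix a
      have "sum_list (map (g \<circ> (a \<circ> h)) [0..<card I]) = (\<Sum>j<card I. g (a (h j)))"
        by (simp add: interv_sum_list_conv_sum_set_nat lessThan_atLeast0)
      then show "sum_list (map (g \<circ> (a \<circ> h)) [0..<card I]) = (\<Sum>i\<in>I. g (a i))"
        by (simp add: sum)
    qed
    show "?G ` {xs. length xs = card I \<and> (\<Sum>x\<leftarrow>xs. g x) = v} \<subseteq> weight_fibre g v I"
    proof (clarsimp simp: weight_fibre_def)
      fix xs :: "nat list" assume len: "length xs = card I"
      have "(\<Sum>i\<in>I. g (xs ! k i)) = (\<Sum>j<card I. g (xs ! k (h j)))"
        using sum[of "\<lambda>i. xs ! k i"] by simp
      also have "\<dots> = (\<Sum>j<card I. g (xs ! j))" by (simp add: kh)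
      also have "\<dots> = (\<Sum>x\<leftarrow>xs. g x)"
        by (simp add: sum_list_sum_nth len lessThan_atLeast0)
      finally show "(\<Sum>i\<in>I. g (xs ! k i)) = (\<Sum>x\<leftarrow>xs. g x)" .
    qed
  qed
  then show ?thesis by (rule bij_betw_same_card)
qed

lemma card_weight_fibre_split:
  fixes g :: "nat \<Rightarrow> 'm::comm_monoid_add"
  assumes "finite I" "J \<subseteq> I"
  shows "card {a \<in> I \<rightarrow>\<^sub>E UNIV. (\<Sum>i\<in>J. g (a i)) = u \<and> (\<Sum>i\<in>I - J. g (a i)) = v}
           = card (weight_fibre g u J) * card (weight_fibre g v (I - J))"
proof -
  let ?A = "{a \<in> I \<rightarrow>\<^sub>E UNIV. (\<Sum>i\<in>J. g (a i)) = u \<and> (\<Sum>i\<in>I - J. g (a i)) = v}"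
  let ?F = "\<lambda>a. (restrict a J, restrict a (I - J))"
  let ?G = "\<lambda>(a, c). \<lambda>i\<in>I. if i \<in> J then a i else c i"
  have "bij_betw ?F ?A (weight_fibre g u J \<times> weight_fibre g v (I - J))"
  proof (rule bij_betw_byWitness[where f' = ?G])
    show "\<forall>a\<in>?A. ?G (?F a) = a"
      using assms(2) by (auto intro!: extensionalityI[where A = I] simp: PiE_def)
    show "\<forall>p\<in>weight_fibre g u J \<times> weight_fibre g v (I - J). ?F (?G p) = p"
    proof
      fix p assume "p \<in> weight_fibre g u J \<times> weight_fibre g v (I - J)"
      then obtain a c where p: "p = (a, c)" "a \<in> weight_fibre g u J"
        "c \<in> weight_fibre g v (I - J)" by blast
      then have ext: "a \<in> extensional J" "c \<in> extensional (I - J)"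
        by (auto simp: weight_fibre_def PiE_def)
      have "restrict (?G (a, c)) J = a"
        by (rule extensionalityI[where A = J]) (use assms(2) ext in auto)
      moreover have "restrict (?G (a, c)) (I - J) = c"
        by (rule extensionalityI[where A = "I - J"]) (use ext in \<open>auto simp del: restrict_restrict\<close>)
      ultimately show "?F (?G p) = p" unfolding p by blast
    qed
    show "?F ` ?A \<subseteq> weight_fibre g u J \<times> weight_fibre g v (I - J)"
      by (auto simp: weight_fibre_def)
    have eq: "(\<Sum>i\<in>J. g (if i \<in> I then if i \<in> J then a i else c i else undefined)) = (\<Sum>i\<in>J. g (a i))"
      "(\<Sum>i\<in>I - J. g (if i \<in> J then a i else c i)) = (\<Sum>i\<in>I - J. g (c i))" for a c
      using assms(2) by (auto intro!: sum.cong)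
    show "?G ` (weight_fibre g u J \<times> weight_fibre g v (I - J)) \<subseteq> ?A"
      using assms(2) by (auto simp: weight_fibre_def eq restrict_def)
  qed
  then show ?thesis by (simp add: bij_betw_same_card card_cartesian_product)
qed

lemma sum_Pow_card:
  fixes f :: "nat \<Rightarrow> 'a::semiring_1"
  assumes "finite I"
  shows "(\<Sum>J\<in>Pow I. f (card J)) = (\<Sum>k\<le>card I. of_nat (card I choose k) * f k)"
proof -
  have "(\<Sum>J\<in>Pow I. f (card J)) = (\<Sum>k\<le>card I. \<Sum>J\<in>{J \<in> Pow I. card J = k}. f (card J))"
    using assms by (intro sum.group[symmetric]) (auto intro: card_mono)
  also have "\<dots> = (\<Sum>k\<le>card I. of_nat (card I choose k) * f k)"
  proof (rule sum.cong[OF refl])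
    fix k
    have "{J \<in> Pow I. card J = k} = {J. J \<subseteq> I \<and> card J = k}" by auto
    then show "(\<Sum>J\<in>{J \<in> Pow I. card J = k}. f (card J)) = of_nat (card I choose k) * f k"
      using n_subsets[OF assms, of k] by simp
  qed
  finally show ?thesis .
qed

lemma card_power_fibre:
  assumes "finite I"
  shows "card (weight_fibre ((^) b) l I) = U b l (card I)"
  using card_weight_fibre[OF assms, of "(^) b" l] by (simp add: U_def power_reps_def)

section \<open>Compositions of an integer into negative powers\<close>

text \<open>Allowing any integer total \<open>c\<close>, not only 1, makes the family closed under
  the recursion: once the terms equal to 1 are removed, multiplication by \<open>b\<close> gives an
  integer total again.\<close>

definition neg_fibre :: "nat \<Rightarrow> nat \<Rightarrow> 'i set \<Rightarrow> ('i \<Rightarrow> nat) set" where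
  "neg_fibre b c I = weight_fibre (\<lambda>k. 1 / real b ^ k) (real c) I"

definition num_comps :: "nat \<Rightarrow> nat \<Rightarrow> nat \<Rightarrow> nat" where
  "num_comps b c n = card {ks. length ks = n \<and> (\<Sum>k\<leftarrow>ks. 1 / real b ^ k) = real c}"

lemma card_neg_fibre:
  assumes "finite I"
  shows "card (neg_fibre b c I) = num_comps b c (card I)"
  using card_weight_fibre[OF assms, of "\<lambda>k. 1 / real b ^ k" "real c"]
  by (simp add: neg_fibre_def num_comps_def)

lemma num_comps_1: "num_comps b 1 n = card (unit_compositions b n)"
  by (simp add: num_comps_def unit_compositions_def)

lemma neg_fibre_le:
  assumes "b \<ge> 2" "finite I" "k \<in> neg_fibre b c I"
  shows "c \<le> card I"
proof -
  have "real c = (\<Sum>i\<in>I. 1 / real b ^ k i)"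
    using assms by (simp add: neg_fibre_def weight_fibre_def)
  also have "\<dots> \<le> (\<Sum>i\<in>I. 1)"
    using assms(1) by (intro sum_mono) (simp add: divide_le_eq)
  finally show ?thesis by simp
qed

lemma neg_fibre_0:
  assumes "b \<ge> 2" "finite I"
  shows "neg_fibre b 0 I = (if I = {} then {\<lambda>_. undefined} else {})"
proof -
  have "\<not> (\<Sum>i\<in>I. 1 / real b ^ k i) = 0" if "I \<noteq> {}" for k
    using assms sum_pos[OF assms(2) that, of "\<lambda>i. 1 / real b ^ k i"] by auto
  then show ?thesis by (auto simp: neg_fibre_def weight_fibre_def)
qed

text \<open>Each zero exponent contributes 1, leaving \<open>c - card Z\<close> for the other terms.
  Lowering their exponents by one multiplies this remainder by \<open>b\<close>.\<close>

lemma neg_fibre_split_zeros: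
  assumes "b \<ge> 2" "finite I" and k: "k \<in> neg_fibre b c I"
  defines "Z \<equiv> {i \<in> I. k i = 0}"
  shows "card Z \<le> c"
    and "(\<lambda>i\<in>I - Z. k i - 1) \<in> neg_fibre b (b * (c - card Z)) (I - Z)"
proof -
  have ZI: "Z \<subseteq> I" by (auto simp: Z_def)
  have *: "1 / real b ^ (k i - 1) = real b * (1 / real b ^ k i)" if "i \<in> I - Z" for i
    using that assms(1) by (cases "k i") (auto simp: Z_def)
  have "real c = (\<Sum>i\<in>I. 1 / real b ^ k i)"
    using k by (simp add: neg_fibre_def weight_fibre_def)
  also have "\<dots> = (\<Sum>i\<in>I - Z. 1 / real b ^ k i) + (\<Sum>i\<in>Z. 1 / real b ^ k i)"
    by (rule sum.subset_diff[OF ZI assms(2)])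
  also have "(\<Sum>i\<in>Z. 1 / real b ^ k i) = real (card Z)" by (simp add: Z_def)
  finally have eq: "real c = (\<Sum>i\<in>I - Z. 1 / real b ^ k i) + real (card Z)" .
  moreover have "0 \<le> (\<Sum>i\<in>I - Z. 1 / real b ^ k i)" by (intro sum_nonneg) simp
  ultimately show le: "card Z \<le> c" by linarith
  have "(\<Sum>i\<in>I - Z. 1 / real b ^ (k i - 1)) = real b * (\<Sum>i\<in>I - Z. 1 / real b ^ k i)"
    by (simp only: sum_distrib_left) (intro sum.cong refl *)
  also have "\<dots> = real (b * (c - card Z))" using eq le by (simp add: of_nat_diff)
  finally show "(\<lambda>i\<in>I - Z. k i - 1) \<in> neg_fibre b (b * (c - card Z)) (I - Z)"
    by (simp add: neg_fibre_def weight_fibre_def)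
qed

text \<open>Multiplying by \<open>b\<close> after removing the zero exponents strictly decreases the number of terms
  minus their sum.\<close>

lemma neg_fibre_exponent_bound:
  assumes "b \<ge> 2" "finite I" "k \<in> neg_fibre b c I" "c \<ge> 1" "i \<in> I"
  shows "k i + c \<le> card I"
  using assms(2-)
proof (induction "card I - c" arbitrary: I k c i rule: less_induct)
  case less
  define Z where "Z = {i \<in> I. k i = 0}"
  define j where "j = c - card Z"
  note sp = neg_fibre_split_zeros[OF assms(1) less.prems(1,2), folded Z_def, folded j_def]
  have cI: "c \<le> card I" by (rule neg_fibre_le[OF assms(1) less.prems(1,2)])
  show ?case
  proof (cases "i \<in> Z")
    case True
    then show ?thesis using cI by (simp add: Z_def)
  next
    case False
    then have iZ: "i \<in> I - Z" using less.prems by auto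
    have fin: "finite (I - Z)" using less.prems by simp
    have j: "j \<noteq> 0"
    proof
      assume "j = 0"
      then have "(\<lambda>i\<in>I - Z. k i - 1) \<in> neg_fibre b 0 (I - Z)" using sp(2) by simp
      then show False using neg_fibre_0[OF assms(1) fin] iZ by (auto split: if_splits)
    qed
    have le: "b * j \<le> card (I - Z)" by (rule neg_fibre_le[OF assms(1) fin sp(2)])
    have card: "card (I - Z) = card I - card Z"
      by (rule card_Diff_subset) (auto simp: Z_def less.prems)
    have "2 * j \<le> b * j" using assms(1) by simp
    then have m: "card (I - Z) - b * j < card I - c"
      using j le card sp(1) j_def by linarith
    have "(\<lambda>i\<in>I - Z. k i - 1) i + b * j \<le> card (I - Z)"
      using m fin sp(2) _ iZ by (rule less.hyps) (use j assms(1) in simp)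
    then have "k i - 1 + b * j \<le> card (I - Z)" using iZ by simp
    then show ?thesis using m \<open>2 * j \<le> b * j\<close> j card sp(1) j_def by linarith
  qed
qed

lemma finite_neg_fibre:
  assumes "b \<ge> 2" "finite I"
  shows "finite (neg_fibre b c I)"
proof (cases "c = 0")
  case True
  then show ?thesis using neg_fibre_0[OF assms] by simp
next
  case False
  have "neg_fibre b c I \<subseteq> I \<rightarrow>\<^sub>E {..card I}"
  proof
    fix k assume k: "k \<in> neg_fibre b c I"
    then have "k i \<le> card I" if "i \<in> I" for i
      using neg_fibre_exponent_bound[OF assms k _ that] False by simp
    then show "k \<in> I \<rightarrow>\<^sub>E {..card I}"
      using k by (auto simp: neg_fibre_def weight_fibre_def PiE_def)
  qed
  then show ?thesis by (rule finite_subset) (intro finite_PiE assms finite_atMost)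
qed

lemma card_neg_fibre_zeros:
  assumes "b \<ge> 2" "finite I" "Z \<subseteq> I" "card Z \<le> c"
  shows "card {k \<in> neg_fibre b c I. {i \<in> I. k i = 0} = Z}
           = card (neg_fibre b (b * (c - card Z)) (I - Z))"
proof -
  let ?A = "{k \<in> neg_fibre b c I. {i \<in> I. k i = 0} = Z}"
  let ?F = "\<lambda>k. \<lambda>i\<in>I - Z. k i - 1"
  let ?G = "\<lambda>k. \<lambda>i\<in>I. if i \<in> Z then 0 else Suc (k i)"
  have "bij_betw ?F ?A (neg_fibre b (b * (c - card Z)) (I - Z))"
  proof (rule bij_betw_byWitness[where f' = ?G])
    show "\<forall>k\<in>?A. ?G (?F k) = k"
    proof
      fix k assume "k \<in> ?A"
      then have "k \<in> extensional I" "Z = {i \<in> I. k i = 0}"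
        by (auto simp: neg_fibre_def weight_fibre_def PiE_def)
      then show "?G (?F k) = k" by (intro extensionalityI[where A = I]) auto
    qed
    show "\<forall>k\<in>neg_fibre b (b * (c - card Z)) (I - Z). ?F (?G k) = k"
      by (auto intro!: extensionalityI[where A = "I - Z"]
          simp: neg_fibre_def weight_fibre_def PiE_def)
    show "?F ` ?A \<subseteq> neg_fibre b (b * (c - card Z)) (I - Z)"
      using neg_fibre_split_zeros(2)[OF assms(1,2)] by blast
    show "?G ` neg_fibre b (b * (c - card Z)) (I - Z) \<subseteq> ?A"
    proof
      fix k' assume "k' \<in> ?G ` neg_fibre b (b * (c - card Z)) (I - Z)"
      then obtain k where k: "k \<in> neg_fibre b (b * (c - card Z)) (I - Z)" and k': "k' = ?G k"
        by blast
      have "(\<Sum>i\<in>I. 1 / real b ^ k' i)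
              = (\<Sum>i\<in>I - Z. 1 / real b ^ k' i) + (\<Sum>i\<in>Z. 1 / real b ^ k' i)"
        by (rule sum.subset_diff[OF assms(3,2)])
      also have "(\<Sum>i\<in>Z. 1 / real b ^ k' i) = real (card Z)"
        using assms(3) by (simp add: k' subset_iff)
      also have "(\<Sum>i\<in>I - Z. 1 / real b ^ k' i) = (\<Sum>i\<in>I - Z. 1 / real b ^ k i) / real b"
        unfolding sum_divide_distrib by (intro sum.cong) (auto simp: k' field_simps)
      also have "\<dots> = real (c - card Z)"
        using k assms(1) by (simp add: neg_fibre_def weight_fibre_def)
      also have "real (c - card Z) + real (card Z) = real c" using assms(4) by simp
      finally have "k' \<in> neg_fibre b c I" by (simp add: neg_fibre_def weight_fibre_def k')
      moreover have "{i \<in> I. k' i = 0} = Z" using assms(3) by (auto simp: k')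
      ultimately show "k' \<in> ?A" by simp
    qed
  qed
  then show ?thesis by (rule bij_betw_same_card)
qed

text \<open>Compositions are sorted by the set of positions with exponent 0, of size
  \<open>d\<close>. The guard \<open>d \<le> c\<close> matters: for \<open>d = n > c\<close> the
  truncated difference \<open>c - d\<close> would be 0 and would wrongly count the empty
  composition.\<close>

lemma num_comps_rec:
  assumes "b \<ge> 2"
  shows "num_comps b c n = (\<Sum>d\<le>n. (n choose d) * (if d \<le> c then num_comps b (b * (c - d)) (n - d) else 0))"
proof -
  let ?I = "{..<n}"
  let ?f = "\<lambda>Z. {k \<in> neg_fibre b c ?I. {i \<in> ?I. k i = 0} = Z}"
  have cI: "card ?I = n" by simp
  have "num_comps b c n = card (neg_fibre b c ?I)" using card_neg_fibre[of ?I b c] by simp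
  also have "neg_fibre b c ?I = (\<Union>Z\<in>Pow ?I. ?f Z)" by auto
  also have "card \<dots> = (\<Sum>Z\<in>Pow ?I. card (?f Z))"
  proof (rule card_UN_disjoint)
    show "\<forall>Z\<in>Pow ?I. finite (?f Z)"
      using finite_neg_fibre[OF assms, of ?I c] by simp
    show "\<forall>Y\<in>Pow ?I. \<forall>Z\<in>Pow ?I. Y \<noteq> Z \<longrightarrow> ?f Y \<inter> ?f Z = {}"
      by (intro ballI impI) (simp only: disjoint_iff mem_Collect_eq, simp)
  qed simp
  also have "\<dots> = (\<Sum>Z\<in>Pow ?I. if card Z \<le> c then num_comps b (b * (c - card Z)) (n - card Z) else 0)"
  proof (rule sum.cong[OF refl])
    fix Z assume Z: "Z \<in> Pow ?I"
    show "card (?f Z) = (if card Z \<le> c then num_comps b (b * (c - card Z)) (n - card Z) else 0)"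
    proof (cases "card Z \<le> c")
      case True
      have "card (?I - Z) = n - card Z"
        using Z by (subst card_Diff_subset) (auto intro: finite_subset)
      then show ?thesis
        using card_neg_fibre_zeros[OF assms, of ?I Z c] Z True
        by (simp add: card_neg_fibre)
    next
      case False
      have "?f Z = {}"
      proof (rule equals0I)
        fix k assume "k \<in> ?f Z"
        then show False using False neg_fibre_split_zeros(1)[OF assms, of ?I k c] by simp
      qed
      then show ?thesis using False by (simp only: card.empty if_False)
    qed
  qed
  also have "\<dots> = (\<Sum>d\<le>card ?I. of_nat (card ?I choose d) *
      (if d \<le> c then num_comps b (b * (c - d)) (n - d) else 0))"
    using sum_Pow_card[of ?I "\<lambda>d. if d \<le> c then num_comps b (b * (c - d)) (n - d) else 0"] by simp
  finally show ?thesis by (simp only: cI of_nat_id)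
qed

lemma num_comps_eq_0:
  assumes "b \<ge> 2" "n < c"
  shows "num_comps b c n = 0"
proof -
  have "neg_fibre b c {..<n} = {}"
    using neg_fibre_le[OF assms(1), of "{..<n}" _ c] assms(2) by fastforce
  then show ?thesis using card_neg_fibre[of "{..<n}" b c] by simp
qed

lemma num_comps_0:
  assumes "b \<ge> 2"
  shows "num_comps b 0 n = (if n = 0 then 1 else 0)"
  using neg_fibre_0[OF assms, of "{..<n}"] card_neg_fibre[of "{..<n}" b 0]
  by (auto simp: lessThan_empty_iff split: if_splits)

text \<open>A level of the tree with \<open>c\<close> nodes, \<open>j\<close> of them internal, carries \<open>c - j\<close> leaves; the next
  level has \<open>b * j\<close> nodes.\<close>

definition leaf_weight :: "nat \<Rightarrow> nat \<Rightarrow> real" where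
  "leaf_weight c j = (if j \<le> c then 1 / fact (c - j) else 0)"

text \<open>A forest with \<open>c\<close> roots and \<open>m\<close> internal nodes has
  \<open>c + (b - 1) * m\<close> leaves, since every internal node trades one leaf for
  \<open>b\<close>. Dividing by the factorial turns the binomials of \<open>num_comps_rec\<close>
  into reciprocal factorials of the leaf counts.\<close>

definition comp_weight :: "nat \<Rightarrow> nat \<Rightarrow> nat \<Rightarrow> real" where
  "comp_weight b c m = real (num_comps b c (c + (b - 1) * m)) / fact (c + (b - 1) * m)"

lemma num_comps_fact_rec:
  assumes "b \<ge> 2"
  shows "real (num_comps b c n) / fact n
     = (\<Sum>d\<le>min c n. real (num_comps b (b * (c - d)) (n - d)) / fact (n - d) / fact d)"
proof -
  have "real (num_comps b c n) / fact n = (\<Sum>d\<le>n. (if d \<le> c then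
     real (num_comps b (b * (c - d)) (n - d)) / fact (n - d) / fact d else 0))"
    unfolding num_comps_rec[OF assms, of c n] of_nat_sum sum_divide_distrib
    by (intro sum.cong refl) (auto simp: binomial_fact)
  also have "\<dots> = (\<Sum>d\<in>{d\<in>{..n}. d \<le> c}. real (num_comps b (b * (c - d)) (n - d)) / fact (n - d) / fact d)"
    by (subst sum.inter_filter) auto
  also have "{d\<in>{..n}. d \<le> c} = {..min c n}" by auto
  finally show ?thesis .
qed

lemma comp_weight_rec:
  assumes "b \<ge> 2"
  shows "comp_weight b c m = (\<Sum>j\<le>m. leaf_weight c j * comp_weight b (b * j) (m - j))"
proof -
  let ?n = "c + (b - 1) * m"
  let ?t = "\<lambda>d. real (num_comps b (b * (c - d)) (?n - d)) / fact (?n - d) / fact d"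
  have "comp_weight b c m = (\<Sum>d\<le>c. ?t d)"
    using num_comps_fact_rec[OF assms, of c ?n] by (simp add: comp_weight_def min_def)
  also have "\<dots> = (\<Sum>j\<le>c. ?t (c - j))"
    by (rule sum.reindex_bij_witness[of _ "\<lambda>j. c - j" "\<lambda>j. c - j"]) auto
  also have "\<dots> = (\<Sum>j\<le>c. if j \<le> m then leaf_weight c j * comp_weight b (b * j) (m - j) else 0)"
  proof (rule sum.cong[OF refl])
    fix j assume j: "j \<in> {..c}"
    have n: "?n - (c - j) = (b - 1) * m + j" and c: "c - (c - j) = j" using j by auto
    show "?t (c - j) = (if j \<le> m then leaf_weight c j * comp_weight b (b * j) (m - j) else 0)"
    proof (cases "j \<le> m")
      case True
      have "(b - 1) * m + j = b * j + (b - 1) * (m - j)"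
        using True assms by (auto simp: le_iff_add algebra_simps)
      then show ?thesis using True j unfolding n c by (simp add: comp_weight_def leaf_weight_def)
    next
      case False
      \<comment> \<open>For \<open>j > m\<close> the remaining \<open>(b - 1) * m + j\<close> terms,
        each at most 1, are too few to reach the total \<open>b * j\<close>.\<close>
      have "b * j = (b - 1) * j + j" using assms by (cases b) auto
      moreover have "(b - 1) * m < (b - 1) * j" using False assms by simp
      ultimately have "(b - 1) * m + j < b * j" by linarith
      then show ?thesis unfolding n c using num_comps_eq_0[OF assms] False by simp
    qed
  qed
  also have "\<dots> = (\<Sum>j\<in>{j\<in>{..c}. j \<le> m}. leaf_weight c j * comp_weight b (b * j) (m - j))"
    by (subst sum.inter_filter) auto
  also have "\<dots> = (\<Sum>j\<le>m. leaf_weight c j * comp_weight b (b * j) (m - j))"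
    by (rule sum.mono_neutral_left) (auto simp: leaf_weight_def)
  finally show ?thesis .
qed

lemma comp_weight_0_left:
  assumes "b \<ge> 2"
  shows "comp_weight b 0 m = (if m = 0 then 1 else 0)"
  using assms by (simp add: comp_weight_def num_comps_0)

lemma comp_weight_0_right:
  assumes "b \<ge> 2"
  shows "comp_weight b c 0 = 1 / fact c"
  using comp_weight_rec[OF assms, of c 0] comp_weight_0_left[OF assms] by (simp add: leaf_weight_def)

lemma comp_weight_Suc:
  assumes "b \<ge> 2" "m > 0"
  shows "comp_weight b c m = (\<Sum>j=1..m. leaf_weight c j * comp_weight b (b * j) (m - j))"
proof -
  have "{..m} = insert 0 {1..m}" by auto
  then show ?thesis
    using assms comp_weight_rec[OF assms(1), of c m] comp_weight_0_left[OF assms(1), of m] by simp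
qed

section \<open>Splitting off a power of the base\<close>

lemma digit_sum_0: "digit_sum b 0 = 0"
  by (simp add: digit_sum_def)

lemma digit_sum_eq_0:
  assumes "b \<ge> 2" "digit_sum b l = 0"
  shows "l = 0"
  using assms(2)
proof (induction l rule: less_induct)
  case (less l)
  show ?case
  proof (rule ccontr)
    assume "l \<noteq> 0"
    have "digit_sum b (b * (l div b) + l mod b) = l mod b + digit_sum b (l div b)"
      using assms(1) by (intro digit_sum_rec) auto
    then have "l mod b = 0" "digit_sum b (l div b) = 0" using less.prems by auto
    moreover from this(2) have "l div b = 0"
      using less.IH[of "l div b"] \<open>l \<noteq> 0\<close> assms(1) by simp
    ultimately show False using \<open>l \<noteq> 0\<close> by (metis div_mult_mod_eq mult_zero_left add_0)
  qed
qed

text \<open>Here \<open>e\<close> is the position of the lowest nonzero digit, and subtracting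
  \<open>b ^ e\<close> lowers that digit by one without a borrow. The divisibility conditions are
  the form in which \<open>subset_sum_lowest_power\<close> uses this position.\<close>

lemma digit_sum_minus_power:
  assumes "b \<ge> 2" "l > 0"
  shows "\<exists>e. b ^ e dvd l \<and> \<not> b ^ Suc e dvd l \<and> digit_sum b l = Suc (digit_sum b (l - b ^ e))"
  using assms(2)
proof (induction l rule: less_induct)
  case (less l)
  define d c where "d = l div b" and "c = l mod b"
  have l: "l = b * d + c" and c: "c < b" using assms(1) by (auto simp: d_def c_def)
  show ?case
  proof (cases "c = 0")
    case True
    then have ld: "l = b * d" using l by simp
    have d: "d > 0" using ld less.prems by (cases "d = 0") simp_all
    have "d < l" using d assms(1) unfolding ld by simp
    from less.IH[OF this d] obtain e where e: "b ^ e dvd d" "\<not> b ^ Suc e dvd d"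
      "digit_sum b d = Suc (digit_sum b (d - b ^ e))" by blast
    have rec: "digit_sum b (b * d + 0) = 0 + digit_sum b d"
      "digit_sum b (b * (d - b ^ e) + 0) = 0 + digit_sum b (d - b ^ e)"
      by (rule digit_sum_rec; use assms(1) in simp)+
    have "l - b ^ Suc e = b * (d - b ^ e)" unfolding ld by (simp add: diff_mult_distrib2)
    then have "digit_sum b l = Suc (digit_sum b (l - b ^ Suc e))"
      using rec e(3) unfolding ld by simp
    moreover have "b ^ Suc e dvd l" "\<not> b ^ Suc (Suc e) dvd l"
      using e(1,2) assms(1) unfolding ld power_Suc[of b "Suc e"] power_Suc[of b e]
      by simp_all
    ultimately show ?thesis by blast
  next
    case False
    then have nd: "\<not> b ^ Suc 0 dvd l" by (simp add: c_def dvd_eq_mod_eq_0)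
    have rec: "digit_sum b (b * d + c) = c + digit_sum b d"
      "digit_sum b (b * d + (c - 1)) = (c - 1) + digit_sum b d"
      by (rule digit_sum_rec; use assms(1) c in simp)+
    have "l - b ^ 0 = b * d + (c - 1)" using False l by simp
    then have "digit_sum b l = Suc (digit_sum b (l - b ^ 0))"
      using rec False l by (metis Suc_pred' add_Suc neq0_conv)
    then show ?thesis using nd by (intro exI[of _ 0]) simp
  qed
qed

lemma digit_sum_plus_power:
  assumes "b \<ge> 2" "l < b ^ e"
  shows "digit_sum b (l + b ^ e) = Suc (digit_sum b l)"
  using assms(2)
proof (induction e arbitrary: l)
  case 0
  have "digit_sum b (b * 0 + 1) = 1 + digit_sum b 0"
    using assms(1) by (intro digit_sum_rec) auto
  then show ?case using 0 by (simp add: digit_sum_0)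
next
  case (Suc e)
  define d c where "d = l div b" and "c = l mod b"
  have l: "l = b * d + c" and c: "c < b" using assms(1) by (auto simp: d_def c_def)
  have "b * d < b * b ^ e" using Suc.prems l unfolding power_Suc by linarith
  then have "d < b ^ e" by simp
  then have IH: "digit_sum b (d + b ^ e) = Suc (digit_sum b d)" by (rule Suc.IH)
  have rec: "digit_sum b (b * (d + b ^ e) + c) = c + digit_sum b (d + b ^ e)"
    "digit_sum b (b * d + c) = c + digit_sum b d"
    using assms(1) c by (intro digit_sum_rec; simp)+
  have "l + b ^ Suc e = b * (d + b ^ e) + c" using l by (simp add: algebra_simps)
  then show ?case using rec(2) IH unfolding l by (simp only: rec(1) add_Suc_right)
qed

text \<open>An inclusion-minimal set of powers with sum at least \<open>b ^ e\<close> has sum exactly \<open>b ^ e\<close>: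
  its smallest member divides both the sum and \<open>b ^ e\<close>.\<close>

lemma subset_sum_power:
  fixes a :: "'i \<Rightarrow> nat" and b :: nat
  assumes "b \<ge> 2" "finite I" "\<And>i. i \<in> I \<Longrightarrow> a i \<le> e" "b ^ e \<le> (\<Sum>i\<in>I. b ^ a i)"
  shows "\<exists>J\<subseteq>I. (\<Sum>i\<in>J. b ^ a i) = b ^ e"
  using assms(2-)
proof (induction "card I" arbitrary: I rule: less_induct)
  case less
  have "(0::nat) < b ^ e" using assms(1) by simp
  then have ne: "I \<noteq> {}" using less.prems by auto
  define i where "i = arg_min_on a I"
  have iI: "i \<in> I" and min: "\<And>j. j \<in> I \<Longrightarrow> a i \<le> a j"
    using ne less.prems(1) by (auto simp: i_def arg_min_if_finite arg_min_least)
  have sum: "(\<Sum>j\<in>I. b ^ a j) = b ^ a i + (\<Sum>j\<in>I - {i}. b ^ a j)"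
    using less.prems(1) iI by (rule sum.remove)
  show ?case
  proof (cases "b ^ e \<le> (\<Sum>j\<in>I - {i}. b ^ a j)")
    case True
    have "card (I - {i}) < card I" using less.prems(1) iI by (rule card_Diff1_less)
    then have "\<exists>J\<subseteq>I - {i}. (\<Sum>i\<in>J. b ^ a i) = b ^ e"
      by (rule less.hyps) (use less.prems True in auto)
    then show ?thesis by blast
  next
    case False
    have "b ^ a i dvd (\<Sum>j\<in>I - {i}. b ^ a j)"
      using min by (intro dvd_sum le_imp_power_dvd) auto
    moreover have "b ^ a i dvd b ^ e" using less.prems(2) iI by (intro le_imp_power_dvd) auto
    ultimately obtain u v where u: "(\<Sum>j\<in>I - {i}. b ^ a j) = b ^ a i * u"
      and v: "b ^ e = b ^ a i * v" by (auto elim!: dvdE)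
    have pos: "0 < b ^ a i" using assms(1) by simp
    have "b ^ a i * u < b ^ a i * v" using False u v by linarith
    then have "u < v" by simp
    moreover have "b ^ a i * v \<le> b ^ a i * (1 + u)"
      using less.prems(3) sum u v by simp
    then have "v \<le> 1 + u" using pos by (simp only: mult_le_cancel1)
    ultimately have "v = 1 + u" by simp
    then have "(\<Sum>j\<in>I. b ^ a j) = b ^ e" using sum u v by simp
    then show ?thesis by blast
  qed
qed

text \<open>Modulo \<open>b ^ Suc e\<close> only the terms with exponent at most \<open>e\<close>
  count. Their sum is a nonzero multiple of \<open>b ^ e\<close>, hence at least
  \<open>b ^ e\<close>, and \<open>subset_sum_power\<close> extracts the exact value.\<close>

lemma subset_sum_lowest_power:
  fixes a :: "'i \<Rightarrow> nat" and b :: nat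
  assumes "b \<ge> 2" "finite I" and l: "(\<Sum>i\<in>I. b ^ a i) = l" "b ^ e dvd l" "\<not> b ^ Suc e dvd l"
  shows "\<exists>J\<subseteq>I. (\<Sum>i\<in>J. b ^ a i) = b ^ e"
proof -
  define I1 where "I1 = {i \<in> I. a i \<le> e}"
  have I1: "I1 \<subseteq> I" "finite I1" using assms(2) by (auto simp: I1_def)
  have sum: "l = (\<Sum>i\<in>I - I1. b ^ a i) + (\<Sum>i\<in>I1. b ^ a i)"
    using sum.subset_diff[OF I1(1) assms(2), of "\<lambda>i. b ^ a i"] l(1) by simp
  have dvd: "b ^ Suc e dvd (\<Sum>i\<in>I - I1. b ^ a i)"
    by (intro dvd_sum le_imp_power_dvd) (auto simp: I1_def)
  then have "b ^ e dvd (\<Sum>i\<in>I - I1. b ^ a i)"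
    by (rule dvd_trans[OF le_imp_power_dvd[OF le_SucI[OF order_refl]]])
  then have "b ^ e dvd (\<Sum>i\<in>I1. b ^ a i)" using l(2) sum by (simp add: dvd_add_right_iff)
  moreover have "(\<Sum>i\<in>I1. b ^ a i) \<noteq> 0"
  proof
    assume "(\<Sum>i\<in>I1. b ^ a i) = 0"
    then have "l = (\<Sum>i\<in>I - I1. b ^ a i)" using sum by linarith
    then show False using l(3) dvd by metis
  qed
  ultimately have "b ^ e \<le> (\<Sum>i\<in>I1. b ^ a i)" by (intro dvd_imp_le) auto
  then have "\<exists>J\<subseteq>I1. (\<Sum>i\<in>J. b ^ a i) = b ^ e"
    by (intro subset_sum_power assms(1) I1(2)) (auto simp: I1_def)
  then show ?thesis using I1(1) by blast
qed

section \<open>Representations of a single power versus compositions of 1\<close>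

lemma power_fibre_exponent_bound:
  fixes b :: nat
  assumes "b \<ge> 2" "finite I" "a \<in> weight_fibre ((^) b) l I" "i \<in> I"
  shows "b ^ a i \<le> l" "a i < l"
proof -
  have "b ^ a i \<le> (\<Sum>i\<in>I. b ^ a i)" using assms(2,4) by (intro member_le_sum) auto
  then show "b ^ a i \<le> l" using assms(3) by (simp add: weight_fibre_def)
  moreover have "a i < b ^ a i" using assms(1) by (intro power_gt_expt) auto
  ultimately show "a i < l" by simp
qed

lemma finite_power_fibre:
  fixes b :: nat
  assumes "b \<ge> 2" "finite I"
  shows "finite (weight_fibre ((^) b) l I)"
proof (rule finite_subset)
  show "weight_fibre ((^) b) l I \<subseteq> I \<rightarrow>\<^sub>E {..l}"
  proof
    fix a assume a: "a \<in> weight_fibre ((^) b) l I"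
    then have "a i \<le> l" if "i \<in> I" for i
      using power_fibre_exponent_bound(2)[OF assms a that] by simp
    then show "a \<in> I \<rightarrow>\<^sub>E {..l}" using a by (auto simp: weight_fibre_def PiE_def)
  qed
qed (intro finite_PiE assms finite_atMost)

text \<open>Dividing a representation of \<open>b ^ e\<close> by \<open>b ^ e\<close> gives a
  composition of 1 and replaces each exponent \<open>a i\<close> by \<open>e - a i\<close>.\<close>

lemma power_fibre_reflect:
  assumes "b \<ge> 2" "finite I" "a \<in> weight_fibre ((^) b) (b ^ e) I"
  shows "(\<lambda>i\<in>I. e - a i) \<in> neg_fibre b 1 I" and "\<And>i. i \<in> I \<Longrightarrow> a i \<le> e"
proof -
  show le: "a i \<le> e" if "i \<in> I" for i
    using power_fibre_exponent_bound(1)[OF assms that] assms(1)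
    by (simp add: power_le_imp_le_exp)
  have "(\<Sum>i\<in>I. 1 / real b ^ (e - a i)) = (\<Sum>i\<in>I. real (b ^ a i) / real b ^ e)"
    using le assms(1) by (intro sum.cong refl) (simp add: power_diff)
  also have "\<dots> = real (\<Sum>i\<in>I. b ^ a i) / real b ^ e"
    by (simp only: sum_divide_distrib of_nat_sum)
  also have "\<dots> = 1" using assms by (simp add: weight_fibre_def)
  finally show "(\<lambda>i\<in>I. e - a i) \<in> neg_fibre b 1 I"
    by (simp add: neg_fibre_def weight_fibre_def)
qed

text \<open>The reflection is injective because no exponent exceeds \<open>e\<close>. For small
  \<open>e\<close> it can miss compositions with an exponent above \<open>e\<close>, so only an
  inequality holds in general.\<close>

lemma U_power_le:
  assumes "b \<ge> 2"
  shows "U b (b ^ e) n \<le> num_comps b 1 n"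
proof -
  let ?I = "{..<n}"
  have "card (weight_fibre ((^) b) (b ^ e) ?I) \<le> card (neg_fibre b 1 ?I)"
  proof (rule card_inj_on_le[where f = "\<lambda>a. \<lambda>i\<in>?I. e - a i"])
    show "inj_on (\<lambda>a. \<lambda>i\<in>?I. e - a i) (weight_fibre ((^) b) (b ^ e) ?I)"
    proof (rule inj_onI)
      fix a a' assume a: "a \<in> weight_fibre ((^) b) (b ^ e) ?I"
        and a': "a' \<in> weight_fibre ((^) b) (b ^ e) ?I"
        and eq: "(\<lambda>i\<in>?I. e - a i) = (\<lambda>i\<in>?I. e - a' i)"
      show "a = a'"
      proof (rule extensionalityI[where A = ?I])
        fix i assume i: "i \<in> ?I"
        have "e - a i = e - a' i" using fun_cong[OF eq, of i] i by simp
        moreover have "a i \<le> e" "a' i \<le> e"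
          using power_fibre_reflect(2)[OF assms _ a i] power_fibre_reflect(2)[OF assms _ a' i] by auto
        ultimately show "a i = a' i" by simp
      qed (use a a' in \<open>auto simp: weight_fibre_def PiE_def\<close>)
    qed
    show "(\<lambda>a. \<lambda>i\<in>?I. e - a i) ` weight_fibre ((^) b) (b ^ e) ?I \<subseteq> neg_fibre b 1 ?I"
      using power_fibre_reflect(1)[OF assms, of ?I _ e] by auto
    show "finite (neg_fibre b 1 ?I)" by (rule finite_neg_fibre[OF assms]) simp
  qed
  then show ?thesis by (simp add: card_power_fibre card_neg_fibre)
qed

text \<open>By \<open>neg_fibre_exponent_bound\<close> a composition of 1 into \<open>n\<close>
  terms has all exponents below \<open>n\<close>, so for \<open>n \<le> e\<close> every composition
  can be reflected back.\<close>

lemma U_power_ge: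
  assumes "b \<ge> 2" "n \<le> e"
  shows "num_comps b 1 n \<le> U b (b ^ e) n"
proof -
  let ?I = "{..<n}"
  have le: "k i \<le> e" if "k \<in> neg_fibre b 1 ?I" "i \<in> ?I" for k i
    using neg_fibre_exponent_bound[OF assms(1) _ that(1) _ that(2)] assms(2) by simp
  have "card (neg_fibre b 1 ?I) \<le> card (weight_fibre ((^) b) (b ^ e) ?I)"
  proof (rule card_inj_on_le[where f = "\<lambda>a. \<lambda>i\<in>?I. e - a i"])
    show "inj_on (\<lambda>a. \<lambda>i\<in>?I. e - a i) (neg_fibre b 1 ?I)"
    proof (rule inj_onI)
      fix a a' assume a: "a \<in> neg_fibre b 1 ?I" and a': "a' \<in> neg_fibre b 1 ?I"
        and eq: "(\<lambda>i\<in>?I. e - a i) = (\<lambda>i\<in>?I. e - a' i)"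
      show "a = a'"
      proof (rule extensionalityI[where A = ?I])
        fix i assume i: "i \<in> ?I"
        have "e - a i = e - a' i" using fun_cong[OF eq, of i] i by simp
        then show "a i = a' i" using le[OF a i] le[OF a' i] by simp
      qed (use a a' in \<open>auto simp: neg_fibre_def weight_fibre_def PiE_def\<close>)
    qed
    show "(\<lambda>a. \<lambda>i\<in>?I. e - a i) ` neg_fibre b 1 ?I \<subseteq> weight_fibre ((^) b) (b ^ e) ?I"
    proof (rule image_subsetI)
      fix k assume k: "k \<in> neg_fibre b 1 ?I"
      have "real (\<Sum>i\<in>?I. b ^ (e - k i)) = (\<Sum>i\<in>?I. real b ^ e * (1 / real b ^ k i))"
        unfolding of_nat_sum
        using le[OF k] assms(1)
        by (intro sum.cong refl, subst of_nat_power, subst power_diff) auto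
      also have "\<dots> = real b ^ e * (\<Sum>i\<in>?I. 1 / real b ^ k i)"
        by (simp only: sum_distrib_left)
      also have "\<dots> = real (b ^ e)"
        using k by (simp add: neg_fibre_def weight_fibre_def)
      finally have "(\<Sum>i\<in>?I. b ^ (e - k i)) = b ^ e" by (simp only: of_nat_eq_iff)
      then show "(\<lambda>i\<in>?I. e - k i) \<in> weight_fibre ((^) b) (b ^ e) ?I"
        by (simp add: weight_fibre_def)
    qed
    show "finite (weight_fibre ((^) b) (b ^ e) ?I)" by (rule finite_power_fibre[OF assms(1)]) simp
  qed
  then show ?thesis by (simp add: card_power_fibre card_neg_fibre)
qed

section \<open>Distributing the positions over two partial sums\<close>

lemma sum_split_U:
  "(\<Sum>J\<in>Pow {..<n}. card {a \<in> {..<n} \<rightarrow>\<^sub>E UNIV. (\<Sum>i\<in>J. b ^ a i) = u \<and> (\<Sum>i\<in>{..<n} - J. b ^ a i) = v})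
     = (\<Sum>k\<le>n. (n choose k) * (U b u k * U b v (n - k)))"
proof -
  have "(\<Sum>J\<in>Pow {..<n}. card {a \<in> {..<n} \<rightarrow>\<^sub>E UNIV. (\<Sum>i\<in>J. b ^ a i) = u \<and> (\<Sum>i\<in>{..<n} - J. b ^ a i) = v})
     = (\<Sum>J\<in>Pow {..<n}. U b u (card J) * U b v (n - card J))"
  proof (rule sum.cong[OF refl])
    fix J assume "J \<in> Pow {..<n}"
    then have J: "J \<subseteq> {..<n}" "finite J" by (auto intro: finite_subset)
    then have "card ({..<n} - J) = n - card J" by (simp add: card_Diff_subset)
    then show "card {a \<in> {..<n} \<rightarrow>\<^sub>E UNIV. (\<Sum>i\<in>J. b ^ a i) = u \<and> (\<Sum>i\<in>{..<n} - J. b ^ a i) = v}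
      = U b u (card J) * U b v (n - card J)"
      using card_weight_fibre_split[OF _ J(1), of "(^) b" u v] J(2) by (simp add: card_power_fibre)
  qed
  also have "\<dots> = (\<Sum>k\<le>n. (n choose k) * (U b u k * U b v (n - k)))"
    using sum_Pow_card[of "{..<n}" "\<lambda>k. U b u k * U b v (n - k)"] by simp
  finally show ?thesis .
qed

text \<open>Every representation of \<open>l\<close> contains a subset of positions summing to
  \<open>b ^ e\<close>, but possibly several such subsets. The right side counts pairs of a
  representation and a subset, hence the inequality.\<close>

lemma U_le_split:
  assumes "b \<ge> 2" "b ^ e dvd l" "\<not> b ^ Suc e dvd l"
  shows "U b l n \<le> (\<Sum>k\<le>n. (n choose k) * (U b (b ^ e) k * U b (l - b ^ e) (n - k)))"
proof -
  let ?I = "{..<n}"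
  let ?A = "\<lambda>J. {a \<in> ?I \<rightarrow>\<^sub>E UNIV. (\<Sum>i\<in>J. b ^ a i) = b ^ e \<and> (\<Sum>i\<in>?I - J. b ^ a i) = l - b ^ e}"
  have sub: "weight_fibre ((^) b) l ?I \<subseteq> (\<Union>J\<in>Pow ?I. ?A J)"
  proof
    fix a assume a: "a \<in> weight_fibre ((^) b) l ?I"
    then have sum: "(\<Sum>i\<in>?I. b ^ a i) = l" by (simp add: weight_fibre_def)
    obtain J where J: "J \<subseteq> ?I" "(\<Sum>i\<in>J. b ^ a i) = b ^ e"
      using subset_sum_lowest_power[OF assms(1) _ sum assms(2,3)] by auto
    have "(\<Sum>i\<in>?I - J. b ^ a i) = l - b ^ e"
      using sum.subset_diff[OF J(1), of "\<lambda>i. b ^ a i"] sum J(2) by simp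
    then show "a \<in> (\<Union>J\<in>Pow ?I. ?A J)" using J a by (auto simp: weight_fibre_def)
  qed
  have fin: "finite (?A J)" if "J \<in> Pow ?I" for J
  proof (rule finite_subset)
    show "?A J \<subseteq> weight_fibre ((^) b) (l - b ^ e + b ^ e) ?I"
    proof
      fix a assume "a \<in> ?A J"
      then show "a \<in> weight_fibre ((^) b) (l - b ^ e + b ^ e) ?I"
        using that sum.subset_diff[of J ?I "\<lambda>i. b ^ a i"] by (simp add: weight_fibre_def)
    qed
  qed (rule finite_power_fibre[OF assms(1)], simp)
  have "U b l n = card (weight_fibre ((^) b) l ?I)" by (simp add: card_power_fibre)
  also have "\<dots> \<le> card (\<Union>J\<in>Pow ?I. ?A J)"
    using sub fin by (intro card_mono finite_UN_I) auto
  also have "\<dots> \<le> (\<Sum>J\<in>Pow ?I. card (?A J))" by (rule card_UN_le) simp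
  finally show ?thesis unfolding sum_split_U .
qed

text \<open>For \<open>e\<close> large the summands contributing to \<open>b ^ e\<close> are recognised by their size.\<close>

lemma U_ge_split:
  assumes "b \<ge> 2" "l + n \<le> e"
  shows "(\<Sum>k\<le>n. (n choose k) * (U b (b ^ e) k * U b l (n - k))) \<le> U b (l + b ^ e) n"
proof -
  let ?I = "{..<n}"
  let ?A = "\<lambda>J. {a \<in> ?I \<rightarrow>\<^sub>E UNIV. (\<Sum>i\<in>J. b ^ a i) = b ^ e \<and> (\<Sum>i\<in>?I - J. b ^ a i) = l}"
  have sub: "?A J \<subseteq> weight_fibre ((^) b) (l + b ^ e) ?I" if "J \<in> Pow ?I" for J
  proof
    fix a assume "a \<in> ?A J"
    then show "a \<in> weight_fibre ((^) b) (l + b ^ e) ?I"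
      using that sum.subset_diff[of J ?I "\<lambda>i. b ^ a i"] by (simp add: weight_fibre_def)
  qed
  have fin: "finite (weight_fibre ((^) b) (l + b ^ e) ?I)"
    by (rule finite_power_fibre[OF assms(1)]) simp
  \<comment> \<open>Exponents inside \<open>J\<close> are at least \<open>e + 1 - n\<close>, hence
    above \<open>l\<close>, while those outside are below \<open>l\<close>. So \<open>J\<close> is
    determined by the representation and nothing is counted twice.\<close>
  have recover: "J = {i \<in> ?I. l < a i}" if J: "J \<in> Pow ?I" and a: "a \<in> ?A J" for J a
  proof -
    have finJ: "finite J" using J by (auto intro: finite_subset)
    have aJ: "restrict a J \<in> weight_fibre ((^) b) (b ^ e) J"
      and aJ': "restrict a (?I - J) \<in> weight_fibre ((^) b) l (?I - J)"
      using a by (auto simp: weight_fibre_def)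
    have "l < a i" if i: "i \<in> J" for i
    proof -
      have "(\<lambda>i\<in>J. e - restrict a J i) i + 1 \<le> card J"
        by (rule neg_fibre_exponent_bound[OF assms(1) finJ
              power_fibre_reflect(1)[OF assms(1) finJ aJ] order_refl i])
      moreover have "card J \<le> n" using J card_mono[of ?I J] by simp
      ultimately show ?thesis using i assms(2) by simp
    qed
    moreover have "a i < l" if i: "i \<in> ?I - J" for i
      using power_fibre_exponent_bound(2)[OF assms(1) _ aJ' i] i by simp
    ultimately show ?thesis using J by force
  qed
  have "(\<Sum>J\<in>Pow ?I. card (?A J)) = card (\<Union>J\<in>Pow ?I. ?A J)"
  proof (rule card_UN_disjoint[symmetric])
    show "\<forall>J\<in>Pow ?I. finite (?A J)" using finite_subset[OF sub fin] by blast
    show "\<forall>J\<in>Pow ?I. \<forall>J'\<in>Pow ?I. J \<noteq> J' \<longrightarrow> ?A J \<inter> ?A J' = {}"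
    proof (intro ballI impI equals0I)
      fix J J' a assume "J \<in> Pow ?I" "J' \<in> Pow ?I" "J \<noteq> J'" "a \<in> ?A J \<inter> ?A J'"
      then show False using recover[of J a] recover[of J' a] by blast
    qed
  qed simp
  also have "\<dots> \<le> card (weight_fibre ((^) b) (l + b ^ e) ?I)"
    using sub fin by (intro card_mono) auto
  finally show ?thesis unfolding sum_split_U by (simp add: card_power_fibre)
qed

section \<open>Exponential generating functions and the maximum\<close>

definition unit_egf :: "nat \<Rightarrow> real fps" where
  "unit_egf b = Abs_fps (\<lambda>n. real (num_comps b 1 n) / fact n)"

lemma binomial_convolution_fact:
  "real (\<Sum>k\<le>n. (n choose k) * (f k * g (n - k))) / fact n
     = (\<Sum>k\<le>n. (real (f k) / fact k) * (real (g (n - k)) / fact (n - k)))"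
  unfolding of_nat_sum sum_divide_distrib
  by (intro sum.cong refl) (simp add: binomial_fact)

lemma U_0: "U b 0 n = (if n = 0 then 1 else 0)" if "b \<ge> 2"
proof (cases n)
  case 0
  have "power_reps b 0 0 = {[]}" by (auto simp: power_reps_def)
  then show ?thesis using 0 by (simp add: U_def)
next
  case (Suc n')
  then have "power_reps b 0 n = {}" using that by (auto simp: power_reps_def length_Suc_conv)
  then show ?thesis using Suc by (simp add: U_def)
qed

text \<open>Induction on the digit sum: peeling off the lowest power lowers it by one, and
  \<open>U_le_split\<close>, after division by \<open>fact n\<close>, is a convolution with one more
  factor \<open>unit_egf b\<close>.\<close>

lemma U_le_unit_egf_power:
  assumes "b \<ge> 2"
  shows "real (U b l n) / fact n \<le> (unit_egf b ^ digit_sum b l) $ n"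
proof (induction "digit_sum b l" arbitrary: l n)
  case 0
  then have "l = 0" using digit_sum_eq_0[OF assms] by simp
  then show ?case using U_0[OF assms] by (simp add: digit_sum_0)
next
  case (Suc s)
  then have "l > 0" by (auto simp: digit_sum_0 intro!: Nat.gr0I)
  then obtain e where e: "b ^ e dvd l" "\<not> b ^ Suc e dvd l"
    "digit_sum b l = Suc (digit_sum b (l - b ^ e))"
    using digit_sum_minus_power[OF assms] by blast
  then have s: "s = digit_sum b (l - b ^ e)" using Suc.hyps(2) by simp
  have "real (U b l n) / fact n
      \<le> real (\<Sum>k\<le>n. (n choose k) * (U b (b ^ e) k * U b (l - b ^ e) (n - k))) / fact n"
    using U_le_split[OF assms e(1,2)] by (intro divide_right_mono) (simp_all only: of_nat_le_iff, simp)
  also have "\<dots> = (\<Sum>k\<le>n. (real (U b (b ^ e) k) / fact k)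
      * (real (U b (l - b ^ e) (n - k)) / fact (n - k)))"
    by (rule binomial_convolution_fact)
  also have "\<dots> \<le> (\<Sum>k\<le>n. unit_egf b $ k * (unit_egf b ^ s) $ (n - k))"
  proof (intro sum_mono mult_mono)
    fix k
    show "real (U b (b ^ e) k) / fact k \<le> unit_egf b $ k"
      using U_power_le[OF assms, of e k] by (simp add: unit_egf_def divide_right_mono)
    show "real (U b (l - b ^ e) (n - k)) / fact (n - k) \<le> (unit_egf b ^ s) $ (n - k)"
      using Suc.hyps(1)[OF s, of "n - k"] s by simp
  qed (auto simp: unit_egf_def)
  also have "\<dots> = (unit_egf b ^ Suc s) $ n"
    by (simp add: fps_mult_nth atLeast0AtMost)
  finally show ?case using Suc.hyps(2) by simp
qed

text \<open>A single \<open>l\<close> has to serve all \<open>n \<le> N\<close> at once, because the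
  convolution in the induction step refers to the previous \<open>l\<close> at every
  \<open>n - k\<close>.\<close>

lemma U_ge_unit_egf_power:
  assumes "b \<ge> 2"
  shows "\<exists>l. digit_sum b l = s \<and> (\<forall>n\<le>N. (unit_egf b ^ s) $ n \<le> real (U b l n) / fact n)"
proof (induction s)
  case 0
  then show ?case using U_0[OF assms] by (intro exI[of _ 0]) (simp add: digit_sum_0)
next
  case (Suc s)
  then obtain l where l: "digit_sum b l = s" "\<And>n. n \<le> N \<Longrightarrow> (unit_egf b ^ s) $ n \<le> real (U b l n) / fact n"
    by blast
  \<comment> \<open>This exponent is at least \<open>l + n\<close> for every
    \<open>n \<le> N\<close>, as \<open>U_ge_split\<close> requires; it is at least \<open>k\<close>
    for every \<open>k \<le> n\<close>, as \<open>U_power_ge\<close> requires; and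
    \<open>l \<le> e < b ^ e\<close> makes the new power a new leading digit.\<close>
  define e where "e = l + N"
  have "e < b ^ e" using assms by (intro power_gt_expt) auto
  then have "digit_sum b (l + b ^ e) = Suc s"
    using digit_sum_plus_power[OF assms, of l e] l(1) by (simp add: e_def)
  moreover have "(unit_egf b ^ Suc s) $ n \<le> real (U b (l + b ^ e) n) / fact n" if n: "n \<le> N" for n
  proof -
    have "(unit_egf b ^ Suc s) $ n = (\<Sum>k\<le>n. unit_egf b $ k * (unit_egf b ^ s) $ (n - k))"
      by (simp add: fps_mult_nth atLeast0AtMost)
    also have "\<dots> \<le> (\<Sum>k\<le>n. (real (U b (b ^ e) k) / fact k) * (real (U b l (n - k)) / fact (n - k)))"
    proof (intro sum_mono)
      fix k assume k: "k \<in> {..n}"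
      have "unit_egf b $ k \<le> real (U b (b ^ e) k) / fact k"
        using U_power_ge[OF assms, of k e] k n by (simp add: unit_egf_def e_def divide_right_mono)
      moreover have "(unit_egf b ^ s) $ (n - k) \<le> real (U b l (n - k)) / fact (n - k)"
        using l(2)[of "n - k"] n by simp
      ultimately have "unit_egf b $ k * (unit_egf b ^ s) $ (n - k)
          \<le> unit_egf b $ k * (real (U b l (n - k)) / fact (n - k))"
        and "unit_egf b $ k * (real (U b l (n - k)) / fact (n - k))
          \<le> (real (U b (b ^ e) k) / fact k) * (real (U b l (n - k)) / fact (n - k))"
        by (intro mult_left_mono mult_right_mono; simp add: unit_egf_def)+
      then show "unit_egf b $ k * (unit_egf b ^ s) $ (n - k)
          \<le> (real (U b (b ^ e) k) / fact k) * (real (U b l (n - k)) / fact (n - k))"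
        by (rule order_trans)
    qed
    also have "\<dots> = real (\<Sum>k\<le>n. (n choose k) * (U b (b ^ e) k * U b l (n - k))) / fact n"
      by (rule binomial_convolution_fact[symmetric])
    also have "\<dots> \<le> real (U b (l + b ^ e) n) / fact n"
      using U_ge_split[OF assms, of l n e] n
      by (intro divide_right_mono) (simp_all only: of_nat_le_iff e_def, simp_all)
    finally show ?thesis .
  qed
  ultimately show ?case by blast
qed

text \<open>The upper bound depends on \<open>l\<close> only through its digit sum, and the
  \<open>l\<close> with widely spaced digits from \<open>U_ge_unit_egf_power\<close> attains
  it.\<close>

lemma W_eq_unit_egf_power:
  assumes "b \<ge> 2" "s \<ge> 1"
  shows "real (W b s n) / fact n = (unit_egf b ^ s) $ n"
proof (rule antisym)
  let ?L = "{l. l > 0 \<and> digit_sum b l = s}"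
  have fin: "finite ((\<lambda>l. U b l n) ` ?L)" by (rule finite_U_image[OF assms(1)])
  have ne: "?L \<noteq> {}" by (rule digit_sum_set_nonempty[OF assms])
  then have "W b s n \<in> (\<lambda>l. U b l n) ` ?L"
    unfolding W_def using fin by (intro Max_in) auto
  then show "real (W b s n) / fact n \<le> (unit_egf b ^ s) $ n"
    using U_le_unit_egf_power[OF assms(1)] by auto
  obtain l where l: "digit_sum b l = s" "(unit_egf b ^ s) $ n \<le> real (U b l n) / fact n"
    using U_ge_unit_egf_power[OF assms(1), of s n] by blast
  then have "l > 0" using assms(2) by (auto simp: digit_sum_0 intro!: Nat.gr0I)
  then have "U b l n \<le> W b s n"
    unfolding W_def using fin l by (intro Max_ge) auto
  then have "real (U b l n) / fact n \<le> real (W b s n) / fact n"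
    by (simp add: divide_right_mono)
  then show "(unit_egf b ^ s) $ n \<le> real (W b s n) / fact n" using l(2) by linarith
qed

section \<open>From the number of terms to the number of internal nodes\<close>

text \<open>The same series as \<open>unit_egf\<close>, with its coefficients indexed by the number
  of internal nodes instead of the number of terms, which removes the coefficients that vanish for
  divisibility reasons.\<close>

definition q_egf :: "nat \<Rightarrow> real fps" where
  "q_egf b = Abs_fps (comp_weight b 1)"

text \<open>The recursion passes from \<open>(c, n)\<close> to \<open>(b * (c - d), n - d)\<close>,
  which preserves \<open>n - c\<close> modulo \<open>b - 1\<close> and strictly decreases it unless
  \<open>d = c\<close>.\<close>

lemma num_comps_nonzero_imp:
  assumes "b \<ge> 2" "num_comps b c n \<noteq> 0"
  shows "\<exists>m. n = (b - 1) * m + c"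
  using assms(2)
proof (induction "n - c" arbitrary: n c rule: less_induct)
  case less
  have cn: "c \<le> n" using num_comps_eq_0[OF assms(1), of n c] less.prems by linarith
  have "(\<Sum>d\<le>n. (n choose d) * (if d \<le> c then num_comps b (b * (c - d)) (n - d) else 0)) \<noteq> 0"
    using less.prems num_comps_rec[OF assms(1), of c n] by simp
  then obtain d where d: "d \<le> n" "d \<le> c" "num_comps b (b * (c - d)) (n - d) \<noteq> 0"
    by (auto simp: sum_eq_0_iff split: if_splits)
  show ?case
  proof (cases "d = c")
    case True
    then have "n = c" using d num_comps_0[OF assms(1), of "n - d"] by (auto split: if_splits)
    then show ?thesis by (intro exI[of _ 0]) simp
  next
    case False
    define j where "j = c - d"
    have j: "j > 0" "c = d + j" using False d(2) by (auto simp: j_def)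
    have le: "b * j \<le> n - d" using num_comps_eq_0[OF assms(1), of "n - d" "b * j"] d(3) j_def not_le by blast
    have "2 * j \<le> b * j" using assms(1) by simp
    then have "n - d - b * j < n - c" using j le d(1) by linarith
    then obtain m where "n - d = (b - 1) * m + b * j"
      using less.hyps[of "n - d" "b * j"] d(3) j_def by blast
    moreover have "b * j = (b - 1) * j + j" using assms(1) by (cases b) auto
    ultimately have "n = (b - 1) * (m + j) + c"
      using j(2) d(1) by (simp add: distrib_left)
    then show ?thesis by blast
  qed
qed

lemma unit_egf_eq_compose:
  assumes "b \<ge> 2"
  shows "unit_egf b = fps_X * (q_egf b oo fps_X ^ (b - 1))"
proof (rule fps_ext)
  fix n
  show "unit_egf b $ n = (fps_X * (q_egf b oo fps_X ^ (b - 1))) $ n"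
  proof (cases n)
    case 0
    then show ?thesis using num_comps_eq_0[OF assms, of 0 1] by (simp add: unit_egf_def)
  next
    case (Suc n')
    show ?thesis
    proof (cases "(b - 1) dvd n'")
      case True
      then obtain m where m: "n' = (b - 1) * m" by (elim dvdE)
      then have "n' div (b - 1) = m" using assms by simp
      then show ?thesis using Suc True m
        by (simp add: fps_nth_compose_X_power unit_egf_def q_egf_def comp_weight_def add.commute)
    next
      case False
      then have "num_comps b 1 n = 0" using num_comps_nonzero_imp[OF assms, of 1 n] Suc by fastforce
      then show ?thesis using Suc False by (simp add: fps_nth_compose_X_power unit_egf_def)
    qed
  qed
qed

lemma unit_egf_power_nth:
  assumes "b \<ge> 2"
  shows "(unit_egf b ^ s) $ ((b - 1) * m + s) = (q_egf b ^ s) $ m"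
proof -
  have "unit_egf b ^ s = fps_X ^ s * (q_egf b ^ s oo fps_X ^ (b - 1))"
    using assms by (simp add: unit_egf_eq_compose power_mult_distrib fps_compose_power)
  moreover have "(b - 1) * m div (b - 1) = m" using assms by simp
  ultimately show ?thesis by (simp add: fps_X_power_mult_nth fps_nth_compose_X_power)
qed

lemma q_egf_nth: "q_egf b $ m = real (q b m) / fact ((b - 1) * m + 1)"
  by (simp add: q_egf_def comp_weight_def q_def num_comps_1[symmetric] add.commute)

lemma W_eq_q_egf_power:
  assumes "b \<ge> 2" "s \<ge> 1"
  shows "real (W b s ((b - 1) * m + s)) / fact ((b - 1) * m + s) = (q_egf b ^ s) $ m"
  using W_eq_unit_egf_power[OF assms] unit_egf_power_nth[OF assms(1)] by simp

lemma W_1_eq_q: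
  assumes "b \<ge> 2"
  shows "W b 1 ((b - 1) * m + 1) = q b m"
proof -
  have "real (W b 1 ((b - 1) * m + 1)) / fact ((b - 1) * m + 1)
      = real (q b m) / fact ((b - 1) * m + 1)"
    using W_eq_q_egf_power[OF assms, of 1 m] unfolding q_egf_nth[symmetric] by simp
  then show ?thesis by (simp only: divide_cancel_right fact_nonzero of_nat_eq_iff simp_thms)
qed

section \<open>The level recursion and its renewal structure\<close>

lemma leaf_weight_nonneg: "0 \<le> leaf_weight c j"
  by (simp add: leaf_weight_def)

text \<open>The sum starts at \<open>j = 2\<close>: levels with exactly one internal node are excluded. The parameter
  \<open>\<phi>\<close> is the weight of stopping at a level with \<open>c\<close> nodes, either because all of them are leaves
  or because exactly one of them is internal.\<close>

function taboo_weight :: "nat \<Rightarrow> (nat \<Rightarrow> real) \<Rightarrow> nat \<Rightarrow> nat \<Rightarrow> real" where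
  "taboo_weight b \<phi> c m = (if m = 0 then \<phi> c else (\<Sum>j=2..m. leaf_weight c j * taboo_weight b \<phi> (b * j) (m - j)))"
  by pat_completeness auto
termination by (relation "Wellfounded.measure (\<lambda>(b, \<phi>, c, m). m)") auto

declare taboo_weight.simps [simp del]

lemma taboo_weight_0: "taboo_weight b \<phi> c 0 = \<phi> c"
  by (simp add: taboo_weight.simps)

lemma taboo_weight_Suc: "m > 0 \<Longrightarrow> taboo_weight b \<phi> c m = (\<Sum>j=2..m. leaf_weight c j * taboo_weight b \<phi> (b * j) (m - j))"
  by (simp add: taboo_weight.simps[of b \<phi> c m])

lemma taboo_weight_nonneg:
  assumes "\<And>c. 0 \<le> \<phi> c"
  shows "0 \<le> taboo_weight b \<phi> c m"
proof (induction m arbitrary: c rule: less_induct)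
  case (less m)
  show ?case
  proof (cases "m = 0")
    case True
    then show ?thesis using assms by (simp add: taboo_weight_0)
  next
    case False
    then show ?thesis
      using less by (auto simp: taboo_weight_Suc leaf_weight_nonneg intro!: sum_nonneg mult_nonneg_nonneg)
  qed
qed

text \<open>The sequence of levels is cut at the first level with exactly one internal node. If
  \<open>k\<close> internal nodes lie on the levels up to and including it, then
  \<open>k - 1\<close> precede it, its leaves contribute \<open>1 / fact (c - 1)\<close> with
  \<open>c\<close> its size, and the next level starts afresh with \<open>b\<close> nodes. The first
  summand collects the sequences without such a level.\<close>

lemma comp_weight_renewal:
  assumes "b \<ge> 2" "c \<ge> 1"
  shows "comp_weight b c m = taboo_weight b (\<lambda>c. 1 / fact c) c m
    + (\<Sum>k=1..m. taboo_weight b (\<lambda>c. 1 / fact (c - 1)) c (k - 1) * comp_weight b b (m - k))"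
  using assms(2)
proof (induction m arbitrary: c rule: less_induct)
  case (less m)
  let ?G = "taboo_weight b (\<lambda>c. 1 / fact c)" and ?F = "taboo_weight b (\<lambda>c. 1 / fact (c - 1))"
  show ?case
  proof (cases "m = 0")
    case True
    then show ?thesis using comp_weight_0_right[OF assms(1)] by (simp add: taboo_weight_0)
  next
    case False
    have split: "{1..m} = insert 1 {2..m}" using False by auto
    \<comment> \<open>This needs \<open>c \<ge> 1\<close>: at \<open>c = 0\<close> the left side is
      0, while truncated subtraction makes the right side 1.\<close>
    have w1: "leaf_weight c 1 = ?F c 0" using less.prems by (simp add: leaf_weight_def taboo_weight_0)
    have "(\<Sum>j=2..m. leaf_weight c j * comp_weight b (b * j) (m - j))
        = (\<Sum>j=2..m. leaf_weight c j * ?G (b * j) (m - j)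
            + (\<Sum>k=1..m - j. leaf_weight c j * ?F (b * j) (k - 1) * comp_weight b b (m - j - k)))"
    proof (rule sum.cong[OF refl])
      fix j assume j: "j \<in> {2..m}"
      have "comp_weight b (b * j) (m - j) = ?G (b * j) (m - j)
          + (\<Sum>k=1..m - j. ?F (b * j) (k - 1) * comp_weight b b (m - j - k))"
        using j assms(1) by (intro less.IH) auto
      then show "leaf_weight c j * comp_weight b (b * j) (m - j) = leaf_weight c j * ?G (b * j) (m - j)
            + (\<Sum>k=1..m - j. leaf_weight c j * ?F (b * j) (k - 1) * comp_weight b b (m - j - k))"
        by (simp only: distrib_left sum_distrib_left mult.assoc)
    qed
    also have "\<dots> = ?G c m
        + (\<Sum>j=2..m. \<Sum>k=1..m - j. leaf_weight c j * ?F (b * j) (k - 1) * comp_weight b b (m - j - k))"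
      using False by (simp add: sum.distrib taboo_weight_Suc)
    \<comment> \<open>The new \<open>k\<close> is the old \<open>j + k\<close>: it now includes the
      \<open>j\<close> internal nodes of the first level.\<close>
    also have "(\<Sum>j=2..m. \<Sum>k=1..m - j. leaf_weight c j * ?F (b * j) (k - 1) * comp_weight b b (m - j - k))
        = (\<Sum>k=2..m. \<Sum>j=2..k - 1. leaf_weight c j * ?F (b * j) (k - 1 - j) * comp_weight b b (m - k))"
      unfolding sum.Sigma[OF finite_atLeastAtMost ballI[OF finite_atLeastAtMost]]
      by (rule sum.reindex_bij_witness[of _ "\<lambda>(k, j). (j, k - j)" "\<lambda>(j, k). (j + k, j)"])
        auto
    also have "\<dots> = (\<Sum>k=2..m. ?F c (k - 1) * comp_weight b b (m - k))"
    proof (rule sum.cong[OF refl])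
      fix k assume "k \<in> {2..m}"
      then have "k - 1 > 0" by simp
      then show "(\<Sum>j=2..k - 1. leaf_weight c j * ?F (b * j) (k - 1 - j) * comp_weight b b (m - k))
          = ?F c (k - 1) * comp_weight b b (m - k)"
        by (simp only: taboo_weight_Suc sum_distrib_right)
    qed
    finally have "comp_weight b c m = leaf_weight c 1 * comp_weight b b (m - 1) + (?G c m
        + (\<Sum>k=2..m. ?F c (k - 1) * comp_weight b b (m - k)))"
      using False comp_weight_Suc[OF assms(1), of m c] unfolding split by simp
    then show ?thesis unfolding split w1 by simp
  qed
qed

section \<open>Bounding the taboo weights by a supersolution\<close>

text \<open>The function \<open>(y / x) ^ i\<close> is a supersolution of the taboo recursion
  weighted by \<open>x\<close>: the factor \<open>x ^ j\<close> of a level cancels against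
  \<open>(y / x) ^ j\<close> to leave \<open>y ^ j\<close>. Supersolution and initial bound are
  required only for \<open>i \<ge> 2\<close>, since all levels after the first have this form; the
  second claim covers an arbitrary first level by one further step of the recursion.\<close>

lemma taboo_weight_bound:
  assumes "x > 0" "y > 0" "C \<ge> 0"
    and super: "\<And>i. i \<ge> 2 \<Longrightarrow> (\<Sum>j=2..b * i. leaf_weight (b * i) j * y ^ j) \<le> (y / x) ^ i"
    and init: "\<And>i. i \<ge> 2 \<Longrightarrow> \<phi> (b * i) \<le> C * (y / x) ^ i"
  shows "i \<ge> 2 \<Longrightarrow> x ^ m * taboo_weight b \<phi> (b * i) m \<le> C * (y / x) ^ i"
    and "m > 0 \<Longrightarrow> x ^ m * taboo_weight b \<phi> c m \<le> C * (\<Sum>j=2..c. leaf_weight c j * y ^ j)"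
proof -
  have step: "x ^ m * taboo_weight b \<phi> c m \<le> C * (\<Sum>j=2..c. leaf_weight c j * y ^ j)"
    if m: "m > 0" and IH: "\<And>j. 2 \<le> j \<Longrightarrow> j \<le> m \<Longrightarrow> x ^ (m - j) * taboo_weight b \<phi> (b * j) (m - j) \<le> C * (y / x) ^ j"
    for c m
  proof -
    have "x ^ m * taboo_weight b \<phi> c m = (\<Sum>j=2..m. (leaf_weight c j * x ^ j) * (x ^ (m - j) * taboo_weight b \<phi> (b * j) (m - j)))"
      unfolding taboo_weight_Suc[OF m] sum_distrib_left
      by (intro sum.cong refl) (simp add: power_add[symmetric])
    also have "\<dots> \<le> (\<Sum>j=2..m. (leaf_weight c j * x ^ j) * (C * (y / x) ^ j))"
      using IH assms(1) by (intro sum_mono mult_left_mono) (auto simp: leaf_weight_nonneg)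
    also have "\<dots> = C * (\<Sum>j=2..m. leaf_weight c j * y ^ j)"
      unfolding sum_distrib_left using assms(1)
      by (intro sum.cong refl) (simp add: power_divide)
    also have "(\<Sum>j=2..m. leaf_weight c j * y ^ j) \<le> (\<Sum>j=2..max m c. leaf_weight c j * y ^ j)"
      using assms(2) by (intro sum_mono2) (auto simp: leaf_weight_nonneg)
    also have "\<dots> = (\<Sum>j=2..c. leaf_weight c j * y ^ j)"
      by (rule sum.mono_neutral_right) (auto simp: leaf_weight_def)
    finally show ?thesis using assms(3) by (simp add: mult_left_mono)
  qed
  have main: "x ^ m * taboo_weight b \<phi> (b * i) m \<le> C * (y / x) ^ i" if "i \<ge> 2" for i m
    using that
  proof (induction m arbitrary: i rule: less_induct)
    case (less m)
    show ?case
    proof (cases "m = 0")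
      case True
      then show ?thesis using init less.prems by (simp add: taboo_weight_0)
    next
      case False
      then have "x ^ m * taboo_weight b \<phi> (b * i) m \<le> C * (\<Sum>j=2..b * i. leaf_weight (b * i) j * y ^ j)"
        by (intro step) (auto intro: less.IH)
      also have "\<dots> \<le> C * (y / x) ^ i"
        using super[OF less.prems] assms(3) by (rule mult_left_mono)
      finally show ?thesis .
    qed
  qed
  then show "i \<ge> 2 \<Longrightarrow> x ^ m * taboo_weight b \<phi> (b * i) m \<le> C * (y / x) ^ i" .
  show "m > 0 \<Longrightarrow> x ^ m * taboo_weight b \<phi> c m \<le> C * (\<Sum>j=2..c. leaf_weight c j * y ^ j)"
    using main by (intro step) auto
qed

lemma power_div_fact_le_exp:
  fixes t :: real
  assumes "t \<ge> 0"
  shows "(\<Sum>i\<le>n. t ^ i / fact i) \<le> exp t"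
proof -
  have "(\<lambda>i. t ^ i / fact i) sums exp t"
    using exp_converges[of t] by (simp add: field_simps)
  then show ?thesis using assms sum_le_suminf[of "\<lambda>i. t ^ i / fact i" "{..n}"]
    by (auto simp: sums_iff)
qed

text \<open>Reversing the sum by \<open>j = n - i\<close> leaves \<open>y ^ n\<close> times a
  partial sum of the exponential series at \<open>1 / y\<close>.\<close>

lemma sum_leaf_weight_le:
  fixes y :: real
  assumes "y > 0"
  shows "(\<Sum>j=2..n. leaf_weight n j * y ^ j) \<le> y ^ n * exp (1 / y)"
proof -
  have "(\<Sum>j=2..n. leaf_weight n j * y ^ j) \<le> (\<Sum>j\<le>n. leaf_weight n j * y ^ j)"
    using assms by (intro sum_mono2) (auto simp: leaf_weight_nonneg)
  also have "\<dots> = (\<Sum>i\<le>n. leaf_weight n (n - i) * y ^ (n - i))"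
    by (rule sum.reindex_bij_witness[of _ "\<lambda>j. n - j" "\<lambda>j. n - j"]) auto
  also have "\<dots> = y ^ n * (\<Sum>i\<le>n. (1 / y) ^ i / fact i)"
    unfolding sum_distrib_left using assms
    by (intro sum.cong refl) (simp add: leaf_weight_def power_diff power_divide)
  also have "\<dots> \<le> y ^ n * exp (1 / y)"
    using assms by (intro mult_left_mono power_div_fact_le_exp) auto
  finally show ?thesis .
qed

text \<open>From \<open>k\<close> to \<open>k + 1\<close> the left side grows by
  \<open>(k + 1) * exp 1\<close>, the right side by \<open>2 * (k + 1) * (1 + 1 / k) ^ k\<close>,
  which is at least \<open>4 * (k + 1)\<close> by Bernoulli. The base case compares
  \<open>2 * exp 1 ^ 2\<close> with 16, for which the estimate of e by 3 would be too
  coarse.\<close>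

lemma fact_exp_le:
  assumes "k \<ge> 2"
  shows "fact k * exp 1 ^ k \<le> (2 * real k) ^ k"
  using assms
proof (induction k rule: nat_induct_at_least)
  case base
  have "exp (1::real) ^ 2 \<le> (28 / 10) ^ 2"
    using e_less_272 by (intro power_mono) auto
  then show ?case by (simp add: power2_eq_square)
next
  case (Suc k)
  have e: "exp (1::real) \<le> 4" using e_less_272 by simp
  have "1 + real k * (1 / real k) \<le> (1 + 1 / real k) ^ k"
    by (rule Bernoulli_inequality, rule order_trans[of _ 0]) simp_all
  then have "2 * real k ^ k \<le> (1 + 1 / real k) ^ k * real k ^ k"
    using Suc.hyps by (intro mult_right_mono) auto
  also have "\<dots> = (real k + 1) ^ k"
    using Suc.hyps by (simp add: power_mult_distrib[symmetric] field_simps)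
  finally have bern: "2 * real k ^ k \<le> (real k + 1) ^ k" .
  have "fact (Suc k) * exp 1 ^ Suc k = (real k + 1) * exp 1 * (fact k * exp 1 ^ k)"
    by (simp add: algebra_simps)
  also have "\<dots> \<le> (real k + 1) * 4 * (2 * real k) ^ k"
    using Suc.IH e by (intro mult_mono) auto
  also have "\<dots> = 2 * (real k + 1) * 2 ^ k * (2 * real k ^ k)"
    by (simp add: power_mult_distrib)
  also have "\<dots> \<le> 2 * (real k + 1) * 2 ^ k * (real k + 1) ^ k"
    using bern by (intro mult_left_mono) auto
  also have "\<dots> = (2 * real (Suc k)) ^ Suc k"
    by (simp only: of_nat_Suc power_Suc power_mult_distrib) (simp only: ac_simps)
  finally show ?case .
qed

text \<open>With \<open>k = b - 1\<close> the choice \<open>y = 1 / (2 * k)\<close> minimises the bound of \<open>sum_leaf_weight_le\<close>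
  at \<open>i = 2\<close>. For \<open>b = 2\<close> that bound is too weak at \<open>i = 2\<close>, where the sum is evaluated exactly.\<close>

lemma leaf_weight_supersolution:
  assumes "b \<ge> 2"
  shows "\<exists>y>0. \<forall>i\<ge>2. (\<Sum>j=2..b * i. leaf_weight (b * i) j * y ^ j) \<le> (y / fact (b - 1)) ^ i"
proof (cases "b = 2")
  case True
  \<comment> \<open>At \<open>i = 2\<close> the sum is 1/18 + 1/27 + 1/81 = 17/162, just below 1/9.
    For \<open>i \<ge> 3\<close> the general estimate suffices, because
    \<open>exp 3 \<le> 27\<close>.\<close>
  define y where "y = (1 / 3 :: real)"
  have "(\<Sum>j=2..2 * i. leaf_weight (2 * i) j * y ^ j) \<le> y ^ i" if i: "i \<ge> 2" for i
  proof (cases "i = 2")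
    case True
    have "{2..4} = {2, 3, 4::nat}" by auto
    then show ?thesis using True by (simp add: leaf_weight_def y_def fact_numeral power_divide)
  next
    case False
    then have i3: "i \<ge> 3" using i by simp
    have "exp (1 / y) = exp (1::real) ^ 3" by (simp add: y_def exp_of_nat_mult[of 3 1, simplified])
    also have "\<dots> \<le> 3 ^ 3" by (intro power_mono exp_le) simp
    finally have e: "exp (1 / y) \<le> 27" by simp
    have "y ^ i \<le> y ^ 3" using i3 by (intro power_decreasing) (auto simp: y_def)
    then have "y ^ i \<le> 1 / 27" by (simp add: y_def power3_eq_cube)
    then have "y ^ i * exp (1 / y) \<le> 1 / 27 * 27"
      using e by (intro mult_mono) (auto simp: y_def)
    then have "y ^ i * (y ^ i * exp (1 / y)) \<le> y ^ i * 1"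
      by (intro mult_left_mono) (auto simp: y_def)
    then have "y ^ (2 * i) * exp (1 / y) \<le> y ^ i"
      by (simp add: mult_2 power_add)
    then show ?thesis using sum_leaf_weight_le[of y "2 * i"] by (simp add: y_def)
  qed
  then show ?thesis using True by (intro exI[of _ y]) (simp add: y_def)
next
  case False
  define k where "k = b - 1"
  have k: "k \<ge> 2" "b = Suc k" using assms False by (auto simp: k_def)
  define y where "y = 1 / (2 * real k)"
  \<comment> \<open>Chosen so that \<open>y ^ b = y / fact k * z\<close>; the claim then reduces to
    \<open>z ^ i * exp (1 / y) \<le> 1\<close>. As \<open>z \<le> 1\<close>, the worst case is
    \<open>i = 2\<close>, where the left side is \<open>(z * exp 1 ^ k) ^ 2\<close>.\<close>
  define z where "z = fact k * y ^ k"
  have y: "y > 0" using k by (simp add: y_def)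
  have z: "z > 0" using y by (simp add: z_def)
  have ze: "z * exp 1 ^ k \<le> 1"
    using fact_exp_le[OF k(1)] k(1) by (simp add: z_def y_def power_divide divide_le_eq)
  have "1 \<le> exp (1::real) ^ k" by (intro one_le_power) simp
  then have "z * 1 \<le> z * exp 1 ^ k" using z by (intro mult_left_mono) auto
  then have z1: "z \<le> 1" using ze by linarith
  have ey: "exp (1 / y) = exp 1 ^ k * exp 1 ^ k"
    by (simp add: y_def exp_of_nat_mult[symmetric] mult_exp_exp)
  have "(\<Sum>j=2..b * i. leaf_weight (b * i) j * y ^ j) \<le> (y / fact k) ^ i" if i: "i \<ge> 2" for i
  proof -
    have "z ^ i \<le> z ^ 2" using i z z1 by (intro power_decreasing) auto
    then have "z ^ i * exp (1 / y) \<le> z ^ 2 * exp (1 / y)" by (intro mult_right_mono) auto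
    also have "\<dots> = (z * exp 1 ^ k) ^ 2" unfolding ey by (simp add: power2_eq_square)
    also have "\<dots> \<le> 1" using ze z by (intro power_le_one) auto
    finally have le: "z ^ i * exp (1 / y) \<le> 1" .
    have "(\<Sum>j=2..b * i. leaf_weight (b * i) j * y ^ j) \<le> y ^ (b * i) * exp (1 / y)"
      by (rule sum_leaf_weight_le[OF y])
    also have "y ^ b = y / fact k * z" by (simp add: z_def k(2))
    then have "y ^ (b * i) = (y / fact k) ^ i * z ^ i"
      by (simp only: power_mult power_mult_distrib)
    also have "(y / fact k) ^ i * z ^ i * exp (1 / y) \<le> (y / fact k) ^ i * 1"
      unfolding mult.assoc using le y by (intro mult_left_mono) auto
    finally show ?thesis by simp
  qed
  then show ?thesis using y by (intro exI[of _ y]) (simp add: k_def)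
qed

text \<open>The growth rate \<open>fact (b - 1)\<close> is the reciprocal of the weight of a level
  of \<open>b\<close> nodes with exactly one internal node. Convergence up to this point is what
  makes the renewal series exceed 1 inside its disc.\<close>

lemma taboo_weight_exponential_bound:
  assumes "b \<ge> 2" and \<phi>: "\<And>i. i \<ge> 1 \<Longrightarrow> \<phi> (b * i) \<le> 1 / fact i"
  shows "\<exists>C. \<forall>m. fact (b - 1) ^ m * taboo_weight b \<phi> b m \<le> C"
proof -
  define x where "x = (fact (b - 1) :: real)"
  have x: "x > 0" by (simp add: x_def)
  obtain y where y: "y > 0"
    and super: "\<And>i. i \<ge> 2 \<Longrightarrow> (\<Sum>j=2..b * i. leaf_weight (b * i) j * y ^ j) \<le> (y / x) ^ i"
    using leaf_weight_supersolution[OF assms(1)] by (auto simp: x_def)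
  \<comment> \<open>Every term \<open>(x / y) ^ i / fact i\<close> of the exponential series is at
    most its sum, so \<open>1 / fact i \<le> C * (y / x) ^ i\<close> for all
    \<open>i\<close>.\<close>
  define C where "C = exp (x / y)"
  have init: "\<phi> (b * i) \<le> C * (y / x) ^ i" if "i \<ge> 2" for i
  proof -
    have "(x / y) ^ i / fact i \<le> (\<Sum>i\<le>i. (x / y) ^ i / fact i)"
      using x y by (intro member_le_sum) auto
    also have "\<dots> \<le> C" unfolding C_def using x y by (intro power_div_fact_le_exp) auto
    finally have "(x / y) ^ i / fact i * (y / x) ^ i \<le> C * (y / x) ^ i"
      using x y by (intro mult_right_mono) auto
    moreover have "(x / y) ^ i / fact i * (y / x) ^ i = 1 / fact i"
      using x y by (simp add: power_divide)
    ultimately show ?thesis using \<phi>[of i] that by simp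
  qed
  define D where "D = C * (\<Sum>j=2..b. leaf_weight b j * y ^ j)"
  have bd: "x ^ m * taboo_weight b \<phi> b m \<le> D" if "m > 0" for m
    unfolding D_def by (rule taboo_weight_bound(2)[OF x y _ super init that]) (auto simp: C_def)
  have "x ^ m * taboo_weight b \<phi> b m \<le> max D (\<phi> b)" for m
    using bd[of m] by (cases "m = 0") (auto simp: taboo_weight_0)
  then show ?thesis unfolding x_def by blast
qed

section \<open>Renewal power series\<close>

definition geom_bounded :: "real \<Rightarrow> real fps \<Rightarrow> bool" where
  "geom_bounded \<kappa> f \<longleftrightarrow> (\<exists>C. \<forall>n. \<bar>f $ n\<bar> \<le> C * \<kappa> ^ n)"

lemma geom_bounded_conv_radius:
  assumes "geom_bounded \<kappa> f" "\<kappa> > 0"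
  shows "fps_conv_radius f \<ge> ereal (1 / \<kappa>)"
  unfolding fps_conv_radius_def
proof (rule conv_radius_geI_ex')
  fix r assume r: "0 < r" "ereal r < ereal (1 / \<kappa>)"
  obtain C where C: "\<And>n. \<bar>f $ n\<bar> \<le> C * \<kappa> ^ n" using assms by (auto simp: geom_bounded_def)
  have "\<kappa> * r < 1" using r assms(2) by (simp add: field_simps)
  then have "summable (\<lambda>n. C * (\<kappa> * r) ^ n)"
    using assms(2) r by (intro summable_mult summable_geometric) auto
  then show "summable (\<lambda>n. f $ n * of_real r ^ n)"
  proof (rule summable_comparison_test'[where N = 0])
    fix n
    have "\<bar>f $ n\<bar> * r ^ n \<le> C * \<kappa> ^ n * r ^ n" using C r by (intro mult_right_mono) auto
    then show "norm (f $ n * of_real r ^ n) \<le> C * (\<kappa> * r) ^ n"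
      using r by (simp add: abs_mult power_mult_distrib)
  qed
qed

lemma conv_radius_geom_bounded:
  assumes "\<kappa> > 0" "fps_conv_radius f > ereal (1 / \<kappa>)"
  shows "geom_bounded \<kappa> f"
proof -
  have "summable (\<lambda>n. f $ n * (1 / \<kappa>) ^ n)"
    using assms by (intro summable_fps) simp
  then have "(\<lambda>n. f $ n * (1 / \<kappa>) ^ n) \<longlonglongrightarrow> 0" by (rule summable_LIMSEQ_zero)
  then have "Bseq (\<lambda>n. f $ n * (1 / \<kappa>) ^ n)" by (intro convergent_imp_Bseq convergentI)
  then obtain C where "\<And>n. norm (f $ n * (1 / \<kappa>) ^ n) \<le> C" by (auto simp: Bseq_def)
  then have "\<bar>f $ n\<bar> \<le> C * \<kappa> ^ n" for n
    using assms(1) by (simp add: abs_mult power_divide divide_le_eq)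
  then show ?thesis by (auto simp: geom_bounded_def)
qed

lemma fps_conv_radius_gt_1E:
  assumes "fps_conv_radius f > 1"
  obtains \<kappa> where "0 < \<kappa>" "\<kappa> < 1" "fps_conv_radius f > ereal (1 / \<kappa>)"
proof -
  obtain r where r: "1 < ereal r" "ereal r < fps_conv_radius f"
    using ereal_dense2[OF assms] by auto
  then show ?thesis using that[of "1 / r"] by simp
qed

text \<open>Division by \<open>1 - X\<close> after subtracting the value at \<open>1\<close> produces the negated tail sums.\<close>

lemma fps_split_at_1:
  assumes "geom_bounded \<kappa> M" "0 < \<kappa>" "\<kappa> < 1"
  defines "M1 \<equiv> Abs_fps (\<lambda>n. (\<Sum>j\<le>n. M $ j) - eval_fps M 1)"
  shows "geom_bounded \<kappa> M1" and "M = fps_const (eval_fps M 1) + (1 - fps_X) * M1"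
proof -
  obtain C where C: "\<And>n. \<bar>M $ n\<bar> \<le> C * \<kappa> ^ n" using assms by (auto simp: geom_bounded_def)
  have "ereal (norm (1::real)) < ereal (1 / \<kappa>)" using assms by simp
  then have rad: "ereal (norm (1::real)) < fps_conv_radius M"
    using geom_bounded_conv_radius[OF assms(1,2)] by (rule less_le_trans)
  have sums: "(\<lambda>n. M $ n) sums eval_fps M 1" using sums_eval_fps[OF rad] by simp
  have "\<bar>M1 $ n\<bar> \<le> C * \<kappa> / (1 - \<kappa>) * \<kappa> ^ n" for n
  proof -
    have geo: "(\<lambda>k. C * \<kappa> ^ (k + Suc n)) sums (C * \<kappa> ^ Suc n * (1 / (1 - \<kappa>)))"
      using sums_mult[OF geometric_sums[of \<kappa>], of "C * \<kappa> ^ Suc n"] assms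
      by (simp add: power_add mult_ac)
    have "(\<lambda>k. M $ (k + Suc n)) sums (eval_fps M 1 - (\<Sum>j<Suc n. M $ j))"
      using sums by (rule sums_split_initial_segment)
    then have M1: "(\<lambda>k. M $ (k + Suc n)) sums (- M1 $ n)"
      by (simp add: M1_def lessThan_Suc_atMost)
    have "\<bar>M1 $ n\<bar> = norm (\<Sum>k. M $ (k + Suc n))"
      using M1 by (simp add: sums_iff)
    also have "\<dots> \<le> (\<Sum>k. C * \<kappa> ^ (k + Suc n))"
    proof (rule norm_suminf_le)
      show "norm (M $ (k + Suc n)) \<le> C * \<kappa> ^ (k + Suc n)" for k
        using C[of "k + Suc n"] by (simp only: real_norm_def)
    qed (rule sums_summable[OF geo])
    also have "\<dots> = C * \<kappa> / (1 - \<kappa>) * \<kappa> ^ n"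
      using geo by (simp add: sums_iff)
    finally show ?thesis .
  qed
  then show "geom_bounded \<kappa> M1" unfolding geom_bounded_def by blast
  show "M = fps_const (eval_fps M 1) + (1 - fps_X) * M1"
  proof (rule fps_ext)
    fix n
    show "M $ n = (fps_const (eval_fps M 1) + (1 - fps_X) * M1) $ n"
      by (cases n) (simp_all add: M1_def left_diff_distrib)
  qed
qed

section \<open>Zero-freeness in the closed complex unit disc\<close>

definition complex_fps :: "real fps \<Rightarrow> complex fps" where
  "complex_fps f = Abs_fps (\<lambda>n. of_real (f $ n))"

lemma complex_fps_nth [simp]: "complex_fps f $ n = of_real (f $ n)"
  by (simp add: complex_fps_def)

lemma fps_conv_radius_complex_fps [simp]: "fps_conv_radius (complex_fps f) = fps_conv_radius f"
proof -
  have "fps_conv_radius (complex_fps f) = conv_radius (\<lambda>n. norm (complex_fps f $ n))"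
    unfolding fps_conv_radius_def by (rule conv_radius_norm[symmetric])
  also have "(\<lambda>n. norm (complex_fps f $ n)) = (\<lambda>n. norm (f $ n))" by simp
  also have "conv_radius \<dots> = fps_conv_radius f"
    unfolding fps_conv_radius_def by (rule conv_radius_norm)
  finally show ?thesis .
qed

lemma complex_fps_mult: "complex_fps (f * g) = complex_fps f * complex_fps g"
  by (rule fps_ext) (simp add: fps_mult_nth)

lemma complex_fps_1: "complex_fps 1 = 1"
  by (rule fps_ext) simp

lemma complex_fps_diff: "complex_fps (f - g) = complex_fps f - complex_fps g"
  by (rule fps_ext) simp

lemma complex_fps_X: "complex_fps fps_X = fps_X"
  by (rule fps_ext) (simp add: fps_X_def)

lemma complex_fps_inverse:
  assumes "f $ 0 \<noteq> 0"
  shows "complex_fps (inverse f) = inverse (complex_fps f)"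
proof -
  have "complex_fps (inverse f) * complex_fps f = 1"
    using assms by (simp add: complex_fps_mult[symmetric] inverse_mult_eq_1 complex_fps_1)
  then show ?thesis using assms by (metis fps_inverse_unique mult.commute)
qed

lemma eval_complex_fps_of_real:
  assumes "ereal (norm x) < fps_conv_radius f"
  shows "eval_fps (complex_fps f) (of_real x) = of_real (eval_fps f x)"
proof -
  have "(\<lambda>n. of_real (f $ n * x ^ n)) sums (of_real (eval_fps f x) :: complex)"
    using sums_eval_fps[OF assms] by (rule sums_of_real)
  then show ?thesis by (simp add: eval_fps_def sums_iff)
qed

text \<open>The zeros in a closed disc slightly larger than the unit disc form a compact set. If it
  is nonempty, its element nearest to 0 has modulus above 1, and the reciprocal converges up to that
  modulus.\<close>

lemma fps_conv_radius_inverse_gt_1: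
  assumes "fps_conv_radius f > 1" "\<And>z. norm z \<le> 1 \<Longrightarrow> eval_fps (complex_fps f) z \<noteq> 0"
  shows "fps_conv_radius (inverse f) > 1"
proof -
  obtain r1 where r1: "1 < ereal r1" "ereal r1 < fps_conv_radius f"
    using ereal_dense2[OF assms(1)] by auto
  have "cball 0 r1 \<subseteq> eball (0::complex) (fps_conv_radius (complex_fps f))"
  proof
    fix z :: complex assume "z \<in> cball 0 r1"
    then have "ereal (norm z) \<le> ereal r1" by simp
    also note r1(2)
    finally show "z \<in> eball 0 (fps_conv_radius (complex_fps f))" by simp
  qed
  then have cont: "continuous_on (cball 0 r1) (eval_fps (complex_fps f))"
    by (rule continuous_on_subset[OF continuous_on_eval_fps])
  define Z where "Z = {z \<in> cball 0 r1. eval_fps (complex_fps f) z = 0}"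
  have "closed Z" unfolding Z_def
    using continuous_closed_preimage_constant[OF cont closed_cball] by simp
  moreover have "bounded Z" unfolding Z_def by (rule bounded_subset[OF bounded_cball[of 0 r1]]) auto
  ultimately have "compact Z" by (simp add: compact_eq_bounded_closed)
  have "\<exists>r>1. r \<le> r1 \<and> (\<forall>z. norm z < r \<longrightarrow> eval_fps (complex_fps f) z \<noteq> 0)"
  proof (cases "Z = {}")
    case True
    then show ?thesis using r1 by (intro exI[of _ r1]) (auto simp: Z_def)
  next
    case False
    obtain z where z: "z \<in> Z" "\<And>w. w \<in> Z \<Longrightarrow> norm z \<le> norm w"
      using continuous_attains_inf[OF \<open>compact Z\<close> False continuous_on_norm[OF continuous_on_id]]
      by blast
    have "norm z > 1" using z(1) assms(2)[of z] by (force simp: Z_def)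
    moreover have "norm z \<le> r1" using z(1) by (simp add: Z_def)
    moreover have "eval_fps (complex_fps f) w \<noteq> 0" if "norm w < norm z" for w
      using z(2)[of w] that \<open>norm z \<le> r1\<close> by (auto simp: Z_def)
    ultimately show ?thesis by blast
  qed
  then obtain r where r: "r > 1" "r \<le> r1" "\<And>z. norm z < r \<Longrightarrow> eval_fps (complex_fps f) z \<noteq> 0" by blast
  have "f $ 0 \<noteq> 0" using assms(2)[of 0] by (simp add: eval_fps_at_0)
  then have eq: "fps_conv_radius (inverse f) = fps_conv_radius (inverse (complex_fps f))"
    by (simp flip: complex_fps_inverse)
  have "min (ereal r) (fps_conv_radius (complex_fps f)) \<le> fps_conv_radius (inverse (complex_fps f))"
    by (rule fps_conv_radius_inverse) (use r(3) in auto)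
  moreover have "1 < min (ereal r) (fps_conv_radius (complex_fps f))" using r(1) assms(1) by simp
  ultimately show ?thesis unfolding eq by (rule less_le_trans[rotated])
qed

text \<open>The coefficients of \<open>p\<close> form a probability distribution, and those of
  \<open>R\<close> are its tails \<open>1 - (\<Sum>j\<le>n. p $ j)\<close>. A zero of
  \<open>R\<close> in the closed unit disc would satisfy p(z) = 1, which \<open>p $ 1 > 0\<close>
  permits only at z = 1; but there \<open>R\<close> is at least \<open>R $ 0 = 1\<close>.\<close>

lemma renewal_quotient:
  fixes p :: "real fps"
  assumes p: "geom_bounded r p" "0 < r" "r < 1" "\<And>n. p $ n \<ge> 0"
    and p01: "p $ 0 = 0" "p $ 1 > 0" and sum1: "eval_fps p 1 = 1"
  shows "\<exists>R. 1 - p = (1 - fps_X) * R \<and> R $ 0 = 1 \<and> fps_conv_radius R > 1 \<and> eval_fps R 1 > 0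
           \<and> fps_conv_radius (inverse R) > 1"
proof -
  have r1: "ereal 1 < ereal (1 / r)" using p by simp
  have rp: "1 < fps_conv_radius p"
    using less_le_trans[OF r1 geom_bounded_conv_radius[OF p(1,2)]] by (simp add: one_ereal_def)
  then have rp': "ereal (norm (1::real)) < fps_conv_radius p" by (simp add: one_ereal_def)
  have gb: "geom_bounded r (1 - p)"
  proof -
    obtain C where C: "\<And>n. \<bar>p $ n\<bar> \<le> C * r ^ n" using p(1) by (auto simp: geom_bounded_def)
    have "\<bar>(1 - p) $ n\<bar> \<le> (C + 1) * r ^ n" for n
      using C[of n] p01 zero_le_power[of r n] p(2)
      by (cases "n = 0") (auto simp: distrib_right fps_one_nth intro: order_trans)
    then show ?thesis unfolding geom_bounded_def by blast
  qed
  have ev: "eval_fps (1 - p) 1 = 0"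
    using eval_fps_diff[of "1::real" 1 p] rp' sum1 by simp
  define R where "R = Abs_fps (\<lambda>n. (\<Sum>j\<le>n. (1 - p) $ j) - eval_fps (1 - p) 1)"
  have "1 - p = fps_const (eval_fps (1 - p) 1) + (1 - fps_X) * R"
    unfolding R_def by (rule fps_split_at_1(2)[OF gb p(2,3)])
  also have "\<dots> = (1 - fps_X) * R" by (simp only: ev fps_const_0_eq_0 add_0_left)
  finally have R: "geom_bounded r R" "1 - p = (1 - fps_X) * R"
    unfolding R_def using fps_split_at_1(1)[OF gb p(2,3)] by blast+
  have rR: "1 < fps_conv_radius R"
    using less_le_trans[OF r1 geom_bounded_conv_radius[OF R(1) p(2)]] by (simp add: one_ereal_def)
  have R0: "R $ 0 = 1" using p01 by (simp add: R_def ev)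
  have psums: "(\<lambda>n. p $ n) sums 1" using sums_eval_fps[OF rp'] sum1 by simp
  have Rnonneg: "R $ n \<ge> 0" for n
  proof -
    have "(\<Sum>j\<le>n. p $ j) \<le> 1"
      using psums p(4) sum_le_suminf[of "\<lambda>n. p $ n" "{..n}"] by (auto simp: sums_iff)
    moreover have "(\<Sum>j\<le>n. (1 - p) $ j) = 1 - (\<Sum>j\<le>n. p $ j)"
      by (simp add: sum_subtractf fps_one_nth)
    ultimately show ?thesis by (simp add: R_def ev)
  qed
  have rR': "ereal (norm (1::real)) < fps_conv_radius R" using rR by (simp add: one_ereal_def)
  have Rsums: "(\<lambda>n. R $ n) sums eval_fps R 1" using sums_eval_fps[OF rR'] by simp
  then have "R $ 0 \<le> eval_fps R 1"
    using sum_le_suminf[of "\<lambda>n. R $ n" "{0}"] Rnonneg by (auto simp: sums_iff)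
  then have R1: "eval_fps R 1 > 0" using R0 by simp
  have "eval_fps (complex_fps R) z \<noteq> 0" if z: "norm z \<le> 1" for z
  proof (cases "z = 1")
    case True
    then show ?thesis using eval_complex_fps_of_real[OF rR'] R1 by simp
  next
    case False
    have zp: "ereal (norm z) < fps_conv_radius (complex_fps p)" and zR: "ereal (norm z) < fps_conv_radius (complex_fps R)"
      using z rp rR le_less_trans[of "ereal (norm z)" 1] by (simp_all add: one_ereal_def)
    have c: "1 - complex_fps p = (1 - fps_X) * complex_fps R"
      using arg_cong[OF R(2), of complex_fps] by (simp only: complex_fps_mult complex_fps_diff complex_fps_1 complex_fps_X)
    \<comment> \<open>Equality in \<open>Re (z ^ n) \<le> 1\<close> for \<open>n = 1\<close> forces \<open>z = 1\<close>.\<close>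
    show ?thesis
    proof
      assume "eval_fps (complex_fps R) z = 0"
      then have "eval_fps ((1 - fps_X) * complex_fps R) z = 0"
        using zR by (subst eval_fps_mult) (auto intro: less_le_trans[OF _ fps_conv_radius_diff])
      then have "eval_fps (1 - complex_fps p) z = 0" by (simp only: c)
      then have pz: "eval_fps (complex_fps p) z = 1" using zp by (simp add: eval_fps_diff)
      have "(\<lambda>n. of_real (p $ n) * z ^ n) sums 1" using sums_eval_fps[OF zp] pz by simp
      then have "(\<lambda>n. Re (of_real (p $ n) * z ^ n)) sums Re 1" by (rule sums_Re)
      then have "(\<lambda>n. p $ n - p $ n * Re (z ^ n)) sums (1 - 1)"
        using psums by (intro sums_diff) simp_all
      then have s0: "(\<lambda>n. p $ n * (1 - Re (z ^ n))) sums 0" by (simp add: algebra_simps)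
      have nn: "0 \<le> p $ n * (1 - Re (z ^ n))" for n
      proof -
        have "Re (z ^ n) \<le> norm (z ^ n)" by (rule complex_Re_le_cmod)
        also have "\<dots> \<le> 1" using z by (simp add: norm_power power_le_one)
        finally show ?thesis using p(4) by simp
      qed
      have "p $ 1 * (1 - Re (z ^ 1)) \<le> 0"
        using s0 nn sum_le_suminf[of "\<lambda>n. p $ n * (1 - Re (z ^ n))" "{1}"] by (auto simp: sums_iff)
      then have "Re z \<ge> 1" using p01(2) by (simp add: mult_le_0_iff)
      moreover have "Re z \<le> norm z" by (rule complex_Re_le_cmod)
      ultimately have z1: "Re z = 1" "norm z = 1" using z by auto
      then have "Im z = 0" using cmod_power2[of z] by simp
      then have "z = 1" using z1 by (simp add: complex_eq_iff)
      then show False using False by contradiction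
    qed
  qed
  then have "fps_conv_radius (inverse R) > 1" using rR by (intro fps_conv_radius_inverse_gt_1)
  then show ?thesis using R(2) R0 rR R1 by blast
qed

section \<open>Coefficients of a series with a pole at 1\<close>

lemma binomial_poly:
  "\<exists>P :: real poly. degree P = s \<and> lead_coeff P = 1 / fact s \<and> (\<forall>n. poly P (real n) = real ((n + s) choose s))"
proof (induction s)
  case 0
  show ?case by (intro exI[of _ 1]) simp
next
  case (Suc s)
  then obtain P :: "real poly" where P: "degree P = s" "lead_coeff P = 1 / fact s"
    "\<And>n. poly P (real n) = real ((n + s) choose s)" by blast
  have P0: "P \<noteq> 0" using P(2) by auto
  define P' where "P' = smult (1 / real (Suc s)) ([:real (Suc s), 1:] * P)"
  have "degree P' = Suc s" using P(1) P0 unfolding P'_def degree_smult_eq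
    by (subst degree_mult_eq) auto
  moreover have "lead_coeff P' = 1 / fact (Suc s)"
    unfolding P'_def lead_coeff_smult lead_coeff_mult P(2) by (simp add: field_simps)
  moreover have "poly P' (real n) = real ((n + Suc s) choose Suc s)" for n
  proof -
    have "real (Suc s * (Suc (n + s) choose Suc s)) = real (Suc (n + s) * ((n + s) choose s))"
      by (simp only: Suc_times_binomial)
    then show ?thesis using P(3)[of n] by (simp add: P'_def field_simps del: binomial_Suc_Suc)
  qed
  ultimately show ?case by blast
qed

lemma inverse_one_minus_X_power_nth:
  "inverse ((1 - fps_X :: real fps) ^ Suc s) $ n = real ((n + s) choose s)"
  using one_minus_const_fps_X_neg_power'[of "Suc s" "1::real"] binomial_symmetric[of n "n + s"]
  by (simp add: add.commute)

text \<open>Induction on the order of the pole. Subtracting M(1) / (1 - X)^(s+1), whose coefficients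
  are M(1) times the polynomial of \<open>binomial_poly\<close>, makes the numerator divisible by 1
  - X. What remains has lower order and does not affect the coefficient of degree
  \<open>s\<close>.\<close>

lemma coeffs_pole_at_1:
  fixes A M :: "real fps"
  assumes "geom_bounded \<kappa> M" "0 < \<kappa>" "\<kappa> < 1" "(1 - fps_X) ^ Suc s * A = M"
  shows "\<exists>P C. degree P \<le> s \<and> coeff P s = eval_fps M 1 / fact s
           \<and> (\<forall>n. \<bar>A $ n - poly P (real n)\<bar> \<le> C * \<kappa> ^ n)"
  using assms(1,4)
proof (induction s arbitrary: M A)
  \<comment> \<open>The premise \<open>lower\<close> asks only that the coefficient of degree
    \<open>s\<close> vanish. This is met by the zero polynomial when no pole is left, and otherwise
    by the induction hypothesis, whose polynomial has smaller degree.\<close>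
  have step: "\<exists>P C. degree P \<le> s \<and> coeff P s = eval_fps M 1 / fact s
           \<and> (\<forall>n. \<bar>A $ n - poly P (real n)\<bar> \<le> C * \<kappa> ^ n)"
    if M: "geom_bounded \<kappa> M" "(1 - fps_X) ^ Suc s * A = M"
      and lower: "\<And>M1 A1. geom_bounded \<kappa> M1 \<Longrightarrow> (1 - fps_X) ^ s * A1 = M1 \<Longrightarrow>
        \<exists>P C. degree P \<le> s \<and> coeff P s = 0 \<and> (\<forall>n. \<bar>A1 $ n - poly P (real n)\<bar> \<le> C * \<kappa> ^ n)"
    for s and M A :: "real fps"
  proof -
    let ?V = "inverse ((1 - fps_X :: real fps) ^ Suc s)"
    define \<mu> where "\<mu> = eval_fps M 1"
    obtain M1 where M1: "geom_bounded \<kappa> M1" "M = fps_const \<mu> + (1 - fps_X) * M1"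
      using fps_split_at_1[OF M(1) assms(2,3)] by (auto simp: \<mu>_def)
    define A1 where "A1 = A - fps_const \<mu> * ?V"
    have "((1 - fps_X :: real fps) ^ Suc s) $ 0 \<noteq> 0" by (simp add: fps_power_zeroth)
    then have V: "(1 - fps_X) ^ Suc s * ?V = 1" by (rule inverse_mult_eq_1')
    have "(1 - fps_X) ^ Suc s * A1 = M - fps_const \<mu> * ((1 - fps_X) ^ Suc s * ?V)"
      unfolding A1_def M(2)[symmetric] by (simp only: right_diff_distrib mult.left_commute)
    also have "\<dots> = (1 - fps_X) * M1" unfolding V by (simp add: M1(2))
    finally have "(1 - fps_X) * ((1 - fps_X) ^ s * A1) = (1 - fps_X) * M1"
      by (simp only: power_Suc mult.assoc)
    moreover have "(1 - fps_X :: real fps) \<noteq> 0"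
    proof
      assume "(1 - fps_X :: real fps) = 0"
      then have "(1 - fps_X :: real fps) $ 0 = 0 $ 0" by (rule arg_cong)
      then show False by simp
    qed
    ultimately have "(1 - fps_X) ^ s * A1 = M1" by (simp only: mult_left_cancel simp_thms)
    then obtain P1 C where P1: "degree P1 \<le> s" "coeff P1 s = 0"
      "\<And>n. \<bar>A1 $ n - poly P1 (real n)\<bar> \<le> C * \<kappa> ^ n" using lower[OF M1(1)] by blast
    obtain P0 :: "real poly" where P0: "degree P0 = s" "lead_coeff P0 = 1 / fact s"
      "\<And>n. poly P0 (real n) = real ((n + s) choose s)" using binomial_poly by blast
    let ?P = "smult \<mu> P0 + P1"
    have "degree ?P \<le> s" using P1(1) P0(1) by (intro degree_add_le) (auto intro: order_trans[OF degree_smult_le])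
    moreover have "coeff ?P s = \<mu> / fact s" using P0(1,2) P1(2) by simp
    moreover have "\<bar>A $ n - poly ?P (real n)\<bar> \<le> C * \<kappa> ^ n" for n
    proof -
      have "A $ n = A1 $ n + \<mu> * real ((n + s) choose s)"
        unfolding A1_def by (simp add: inverse_one_minus_X_power_nth del: power_Suc)
      then show ?thesis using P1(3)[of n] P0(3)[of n] by simp
    qed
    ultimately show ?thesis unfolding \<mu>_def by blast
  qed
  {
    case (0 M A)
    show ?case
    proof (rule step[OF 0])
      fix M1 A1 :: "real fps"
      assume "geom_bounded \<kappa> M1" "(1 - fps_X) ^ 0 * A1 = M1"
      then show "\<exists>P C. degree P \<le> 0 \<and> coeff P 0 = 0 \<and> (\<forall>n. \<bar>A1 $ n - poly P (real n)\<bar> \<le> C * \<kappa> ^ n)"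
        unfolding geom_bounded_def by (intro exI[of _ "0 :: real poly"]) simp
    qed
  next
    case (Suc s M A)
    show ?case
    proof (rule step[OF Suc(2,3)])
      fix M1 A1 :: "real fps"
      assume "geom_bounded \<kappa> M1" "(1 - fps_X) ^ Suc s * A1 = M1"
      from Suc.IH[OF this] obtain P C where "degree P \<le> s"
        "\<forall>n. \<bar>A1 $ n - poly P (real n)\<bar> \<le> C * \<kappa> ^ n" by blast
      then show "\<exists>P C. degree P \<le> Suc s \<and> coeff P (Suc s) = 0
          \<and> (\<forall>n. \<bar>A1 $ n - poly P (real n)\<bar> \<le> C * \<kappa> ^ n)"
        by (intro exI[of _ P] exI[of _ C]) (auto simp: coeff_eq_0)
    qed
  }
qed

section \<open>Rescaling to the dominant singularity\<close>

text \<open>The substitution of c X for X; with \<open>c\<close> the root of F = 1 it moves the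
  dominant singularity to 1.\<close>

definition fps_scale :: "real \<Rightarrow> real fps \<Rightarrow> real fps" where
  "fps_scale c f = Abs_fps (\<lambda>n. c ^ n * f $ n)"

lemma fps_scale_nth [simp]: "fps_scale c f $ n = c ^ n * f $ n"
  by (simp add: fps_scale_def)

lemma fps_scale_mult: "fps_scale c (f * g) = fps_scale c f * fps_scale c g"
proof (rule fps_ext)
  fix n
  show "fps_scale c (f * g) $ n = (fps_scale c f * fps_scale c g) $ n"
    unfolding fps_scale_nth fps_mult_nth sum_distrib_left
    by (intro sum.cong refl) (auto simp: power_add[symmetric])
qed

lemma fps_scale_add: "fps_scale c (f + g) = fps_scale c f + fps_scale c g"
  by (rule fps_ext) (simp add: distrib_left)

lemma fps_scale_1: "fps_scale c 1 = 1"
  by (rule fps_ext) (simp add: fps_one_nth)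

lemma fps_scale_X: "fps_scale c fps_X = fps_const c * fps_X"
  by (rule fps_ext) (simp add: fps_X_def)

lemma fps_scale_power: "fps_scale c (f ^ s) = fps_scale c f ^ s"
  by (induction s) (simp_all add: fps_scale_1 fps_scale_mult)

lemma geom_bounded_fps_scale:
  assumes "geom_bounded \<kappa> f" "c > 0"
  shows "geom_bounded (c * \<kappa>) (fps_scale c f)"
proof -
  obtain C where C: "\<And>n. \<bar>f $ n\<bar> \<le> C * \<kappa> ^ n" using assms by (auto simp: geom_bounded_def)
  have "\<bar>fps_scale c f $ n\<bar> \<le> C * (c * \<kappa>) ^ n" for n
    using mult_left_mono[OF C[of n], of "c ^ n"] assms(2)
    by (simp add: abs_mult power_mult_distrib mult_ac)
  then show ?thesis unfolding geom_bounded_def by blast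
qed

text \<open>Convergence at \<open>x\<close> itself is not known, so \<open>F\<close> is bounded
  below by two of its terms. That polynomial exceeds 1 at \<open>x\<close>, hence also at some
  \<open>t < x\<close>, and the intermediate value theorem applies on \<open>{0..t}\<close>.\<close>

lemma exists_root_eval_fps:
  fixes F :: "real fps"
  assumes "ereal x \<le> fps_conv_radius F" "x > 0" "\<And>n. F $ n \<ge> 0" "F $ 0 = 0"
    and "F $ 1 * x \<ge> 1" "F $ 3 > 0"
  shows "\<exists>\<rho>. 0 < \<rho> \<and> \<rho> < x \<and> eval_fps F \<rho> = 1"
proof -
  define \<phi> where "\<phi> = (\<lambda>t. F $ 1 * t + F $ 3 * t ^ 3)"
  have "(\<phi> \<longlongrightarrow> \<phi> x) (at_left x)" unfolding \<phi>_def by (intro tendsto_intros)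
  moreover have "F $ 3 * x ^ 3 > 0" using assms by simp
  then have "\<phi> x > 1" using assms(5) unfolding \<phi>_def by linarith
  ultimately have "\<forall>\<^sub>F t in at_left x. \<phi> t > 1" by (rule order_tendstoD)
  moreover have "\<forall>\<^sub>F t in at_left x. t \<in> {0<..<x}"
    by (rule eventually_at_leftI[of 0]) (use assms in auto)
  ultimately have "\<forall>\<^sub>F t in at_left x. \<phi> t > 1 \<and> t \<in> {0<..<x}" by (rule eventually_conj)
  then obtain t where t: "\<phi> t > 1" "0 < t" "t < x"
    using eventually_happens'[OF trivial_limit_at_left_real] by force
  have rad: "ereal (norm u) < fps_conv_radius F" if "0 \<le> u" "u \<le> t" for u
  proof -
    have "ereal (norm u) < ereal x" using that t by simp
    also note assms(1)
    finally show ?thesis .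
  qed
  have "(\<lambda>n. F $ n * t ^ n) sums eval_fps F t" using t by (intro sums_eval_fps rad) auto
  then have "(\<Sum>n\<in>{1, 3}. F $ n * t ^ n) \<le> eval_fps F t"
    using sum_le_suminf[of "\<lambda>n. F $ n * t ^ n" "{1, 3}"] assms(3) t by (auto simp: sums_iff)
  then have "\<phi> t \<le> eval_fps F t" by (simp add: \<phi>_def)
  then have ge: "eval_fps F t \<ge> 1" using t by simp
  have "continuous_on {0..t} (eval_fps F)"
    by (rule continuous_on_subset[OF continuous_on_eval_fps]) (use rad in auto)
  then obtain \<rho> where \<rho>: "0 \<le> \<rho>" "\<rho> \<le> t" "eval_fps F \<rho> = 1"
    using IVT'[of "eval_fps F" 0 1 t] ge t assms(4) by (auto simp: eval_fps_at_0)
  moreover have "\<rho> \<noteq> 0" using \<rho>(3) assms(4) by (auto simp: eval_fps_at_0)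
  ultimately show ?thesis using t by (intro exI[of _ \<rho>]) auto
qed

lemma conv_radius_gt_1_geom:
  assumes "geom_bounded \<kappa> f" "0 < \<kappa>" "\<kappa> < 1"
  shows "fps_conv_radius f > 1"
proof -
  have "(1::ereal) < ereal (1 / \<kappa>)" using assms by (simp add: one_ereal_def)
  then show ?thesis using geom_bounded_conv_radius[OF assms(1,2)] by (rule less_le_trans)
qed

text \<open>After rescaling, \<open>y = S / (1 - X)\<close> with \<open>S = g / R\<close>, so
  \<open>1 + X * Y\<close> becomes \<open>Z = N / (1 - X)\<close> with \<open>N\<close> analytic
  beyond the unit disc and N(1) = \<alpha> > 0. The powers of \<open>Z\<close> then fall under
  \<open>coeffs_pole_at_1\<close> with numerator \<open>N ^ Suc s\<close>.\<close>

theorem renewal_power_asymptotics: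
  fixes F G Y :: "real fps"
  assumes x: "x > 0"
    and F: "geom_bounded (1 / x) F" "\<And>n. F $ n \<ge> 0" "F $ 0 = 0" "F $ 1 * x \<ge> 1" "F $ 3 > 0"
    and G: "geom_bounded (1 / x) G" "\<And>n. G $ n \<ge> 0" "G $ 0 > 0"
    and Y: "Y = G + F * Y"
  shows "\<exists>\<alpha> \<rho> \<kappa>. \<alpha> > 0 \<and> \<rho> > 0 \<and> 0 < \<kappa> \<and> \<kappa> < 1 \<and> (\<forall>s. \<exists>P C.
    degree P = s \<and> lead_coeff P = \<alpha> ^ Suc s / fact s \<and>
    (\<forall>n. \<bar>\<rho> ^ n * ((1 + fps_X * Y) ^ Suc s) $ n - poly P (real n)\<bar> \<le> C * \<kappa> ^ n))"
proof -
  have "ereal x \<le> fps_conv_radius F" using geom_bounded_conv_radius[OF F(1)] x by simp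
  then obtain \<rho> where \<rho>: "0 < \<rho>" "\<rho> < x" "eval_fps F \<rho> = 1"
    using exists_root_eval_fps[OF _ x F(2-5)] by blast
  define r where "r = \<rho> * (1 / x)"
  have r: "0 < r" "r < 1" using \<rho> x by (auto simp: r_def)
  define p g y where "p = fps_scale \<rho> F" and "g = fps_scale \<rho> G" and "y = fps_scale \<rho> Y"
  have gp: "geom_bounded r p" and gg: "geom_bounded r g"
    unfolding p_def g_def r_def using F(1) G(1) \<rho>(1) by (intro geom_bounded_fps_scale; simp)+
  have "eval_fps p 1 = eval_fps F \<rho>" by (simp add: eval_fps_def p_def mult.commute)
  moreover have "F $ 1 > 0" using F(4) x by (metis less_le_trans zero_less_one zero_less_mult_pos2)
  ultimately obtain R where R: "1 - p = (1 - fps_X) * R" "R $ 0 = 1" "fps_conv_radius R > 1"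
    "eval_fps R 1 > 0" "fps_conv_radius (inverse R) > 1"
    using renewal_quotient[OF gp r] F(2,3) \<rho> by (auto simp: p_def)
  define S where "S = g * inverse R"
  have rg: "fps_conv_radius g > 1" by (rule conv_radius_gt_1_geom[OF gg r])
  have rS: "fps_conv_radius S > 1"
    using R(5) rg less_le_trans[OF _ fps_conv_radius_mult[of g "inverse R"]] by (simp add: S_def)
  have SR: "S * R = g" using R(2) by (simp add: S_def mult.assoc inverse_mult_eq_1)
  have "y = g + p * y" unfolding p_def g_def y_def using Y by (metis fps_scale_add fps_scale_mult)
  then have "(1 - p) * y = g" by (simp add: algebra_simps)
  then have "R * ((1 - fps_X) * y) = R * S" using SR R(1) by (simp only: mult_ac)
  moreover have "R \<noteq> 0" using R(2) by auto
  ultimately have yS: "(1 - fps_X) * y = S" by (simp only: mult_left_cancel simp_thms)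
  have "eval_fps g 1 > 0"
  proof -
    have "(\<lambda>n. g $ n) sums eval_fps g 1"
      using sums_eval_fps[of "1::real" g] rg by (simp add: one_ereal_def)
    then have "g $ 0 \<le> eval_fps g 1"
      using sum_le_suminf[of "\<lambda>n. g $ n" "{0}"] G(2) \<rho>(1) by (auto simp: sums_iff g_def)
    then show ?thesis using G(3) by (simp add: g_def)
  qed
  moreover have "eval_fps g 1 = eval_fps S 1 * eval_fps R 1"
    unfolding SR[symmetric] using rS R(3) by (intro eval_fps_mult) (simp_all add: one_ereal_def)
  ultimately have S1: "eval_fps S 1 > 0" using R(4) by (simp add: zero_less_mult_iff)
  define Z where "Z = fps_scale \<rho> (1 + fps_X * Y)"
  define N where "N = (1 - fps_X) * Z"
  have "Z = 1 + fps_const \<rho> * fps_X * y"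
    by (simp add: Z_def y_def fps_scale_add fps_scale_1 fps_scale_mult fps_scale_X)
  then have N: "N = (1 - fps_X) + fps_const \<rho> * fps_X * S"
    unfolding N_def yS[symmetric] by (simp add: algebra_simps)
  have rX: "fps_conv_radius (1 - fps_X :: real fps) = \<infinity>"
    using fps_conv_radius_diff[of 1 "fps_X :: real fps"] by simp
  have rXS: "fps_conv_radius (fps_const \<rho> * fps_X * S) > 1"
    using fps_conv_radius_mult[of "fps_const \<rho> * fps_X" S]
      fps_conv_radius_mult[of "fps_const \<rho>" "fps_X :: real fps"] rS
    by (simp add: min_def split: if_splits)
  have rN: "fps_conv_radius N > 1"
    unfolding N using rX rXS fps_conv_radius_add[of "1 - fps_X" "fps_const \<rho> * fps_X * S"]
    by (simp add: min_def split: if_splits)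
  define \<alpha> where "\<alpha> = \<rho> * eval_fps S 1"
  have \<alpha>: "\<alpha> > 0" using \<rho>(1) S1 by (simp add: \<alpha>_def)
  have N1: "eval_fps N 1 = \<alpha>"
  proof -
    have e1: "eval_fps (1 - fps_X) (1::real) = 0" by (subst eval_fps_diff) auto
    have e2: "eval_fps (fps_const \<rho> * fps_X) (1::real) = \<rho>" by (subst eval_fps_mult) auto
    have "fps_conv_radius (fps_const \<rho> * fps_X :: real fps) = \<infinity>"
      using fps_conv_radius_mult[of "fps_const \<rho>" "fps_X :: real fps"] by simp
    then have e3: "eval_fps (fps_const \<rho> * fps_X * S) 1 = \<alpha>"
      unfolding \<alpha>_def using rS by (subst eval_fps_mult) (simp_all add: e2 one_ereal_def)
    show ?thesis unfolding N using rX rXS e1 e3 by (subst eval_fps_add) (simp_all add: one_ereal_def)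
  qed
  \<comment> \<open>Fixed before \<open>s\<close>: powers of \<open>N\<close> have radius of
    convergence at least that of \<open>N\<close>, so one \<kappa> serves all exponents.\<close>
  obtain \<kappa> where \<kappa>: "0 < \<kappa>" "\<kappa> < 1" "fps_conv_radius N > ereal (1 / \<kappa>)"
    using fps_conv_radius_gt_1E[OF rN] .
  have "\<exists>P C. degree P = s \<and> lead_coeff P = \<alpha> ^ Suc s / fact s \<and>
    (\<forall>n. \<bar>\<rho> ^ n * ((1 + fps_X * Y) ^ Suc s) $ n - poly P (real n)\<bar> \<le> C * \<kappa> ^ n)" for s
  proof -
    have "geom_bounded \<kappa> (N ^ Suc s)"
      using \<kappa>(1) less_le_trans[OF \<kappa>(3) fps_conv_radius_power] by (rule conv_radius_geom_bounded)
    moreover have "(1 - fps_X) ^ Suc s * Z ^ Suc s = N ^ Suc s"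
      unfolding N_def by (simp only: power_mult_distrib)
    ultimately obtain P C where P: "degree P \<le> s" "coeff P s = eval_fps (N ^ Suc s) 1 / fact s"
      "\<And>n. \<bar>(Z ^ Suc s) $ n - poly P (real n)\<bar> \<le> C * \<kappa> ^ n"
      using coeffs_pole_at_1[OF _ \<kappa>(1,2)] by blast
    have "eval_fps (N ^ Suc s) 1 = \<alpha> ^ Suc s"
      using N1 rN by (subst eval_fps_power) (simp_all add: one_ereal_def)
    then have c: "coeff P s = \<alpha> ^ Suc s / fact s" using P(2) by simp
    then have "coeff P s \<noteq> 0" using \<alpha> by simp
    then have "degree P = s" using P(1) le_degree[of P s] by simp
    moreover have "(Z ^ Suc s) $ n = \<rho> ^ n * ((1 + fps_X * Y) ^ Suc s) $ n" for n
      unfolding Z_def fps_scale_power[symmetric] fps_scale_nth ..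
    ultimately show ?thesis using c P(3) by (intro exI[of _ P] exI[of _ C]) simp
  qed
  then show ?thesis using \<alpha> \<rho>(1) \<kappa>(1,2) by blast
qed

section \<open>Asymptotics\<close>

text \<open>A single root is either a leaf, giving the term 1, or the only internal node of its
  level, giving a factor X and a next level of \<open>b\<close> nodes.\<close>

lemma q_egf_eq:
  assumes "b \<ge> 2"
  shows "q_egf b = 1 + fps_X * Abs_fps (comp_weight b b)"
proof (rule fps_ext)
  fix n
  show "q_egf b $ n = (1 + fps_X * Abs_fps (comp_weight b b)) $ n"
  proof (cases n)
    case 0
    then show ?thesis using comp_weight_0_right[OF assms] by (simp add: q_egf_def)
  next
    case (Suc m)
    have "comp_weight b 1 n = (\<Sum>j=1..n. leaf_weight 1 j * comp_weight b (b * j) (n - j))"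
      using comp_weight_Suc[OF assms] Suc by simp
    also have "\<dots> = (\<Sum>j\<in>{1}. leaf_weight 1 j * comp_weight b (b * j) (n - j))"
      by (rule sum.mono_neutral_right) (auto simp: leaf_weight_def Suc)
    finally show ?thesis by (simp add: q_egf_def leaf_weight_def Suc)
  qed
qed

lemma taboo_weight_geom_bounded:
  assumes "b \<ge> 2" "\<And>i. i \<ge> 1 \<Longrightarrow> \<phi> (b * i) \<le> 1 / fact i" "\<And>c. 0 \<le> \<phi> c"
  shows "geom_bounded (1 / fact (b - 1)) (Abs_fps (taboo_weight b \<phi> b))"
proof -
  obtain C where C: "\<And>m. fact (b - 1) ^ m * taboo_weight b \<phi> b m \<le> C"
    using taboo_weight_exponential_bound[of b \<phi>] assms(1,2) by blast
  have "\<bar>taboo_weight b \<phi> b m\<bar> \<le> C * (1 / fact (b - 1)) ^ m" for m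
    using C[of m] taboo_weight_nonneg[of \<phi> b b m] assms(3) by (simp add: power_divide field_simps)
  then show ?thesis by (auto simp: geom_bounded_def)
qed

lemma geom_bounded_X_mult:
  assumes "geom_bounded \<kappa> f" "\<kappa> > 0"
  shows "geom_bounded \<kappa> (fps_X * f)"
proof -
  obtain C where C: "\<And>n. \<bar>f $ n\<bar> \<le> C * \<kappa> ^ n" using assms by (auto simp: geom_bounded_def)
  have "C \<ge> 0" using C[of 0] by simp
  have "\<bar>(fps_X * f) $ n\<bar> \<le> C / \<kappa> * \<kappa> ^ n" for n
    using C[of "n - 1"] \<open>C \<ge> 0\<close> assms(2) by (cases n) (auto simp: field_simps)
  then show ?thesis unfolding geom_bounded_def by blast
qed

lemma q_egf_power_asymptotics:
  assumes "b \<ge> 2"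
  shows "\<exists>\<alpha> \<rho> \<kappa>. \<alpha> > 0 \<and> \<rho> > 0 \<and> 0 < \<kappa> \<and> \<kappa> < 1 \<and> (\<forall>s. \<exists>P C.
    degree P = s \<and> lead_coeff P = \<alpha> ^ Suc s / fact s \<and>
    (\<forall>n. \<bar>\<rho> ^ n * (q_egf b ^ Suc s) $ n - poly P (real n)\<bar> \<le> C * \<kappa> ^ n))"
proof -
  let ?\<phi> = "\<lambda>c. 1 / fact c :: real" and ?\<psi> = "\<lambda>c. 1 / fact (c - 1) :: real"
  define x where "x = (fact (b - 1) :: real)"
  \<comment> \<open>The factor \<open>fps_X\<close> in \<open>F\<close> accounts for the single
    internal node on the level at which the sequence is cut.\<close>
  define G F Y where "G = Abs_fps (taboo_weight b ?\<phi> b)" and "F = fps_X * Abs_fps (taboo_weight b ?\<psi> b)"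
    and "Y = Abs_fps (comp_weight b b)"
  have le: "i \<le> b * i - 1" if "i \<ge> 1" for i
  proof -
    have "2 * i \<le> b * i" using assms by simp
    then show ?thesis using that by linarith
  qed
  have x: "x > 0" by (simp add: x_def)
  have \<phi>: "?\<phi> (b * i) \<le> 1 / fact i" if "i \<ge> 1" for i
    using order_trans[OF le[OF that] diff_le_self] by (intro divide_left_mono fact_mono) auto
  have \<psi>: "?\<psi> (b * i) \<le> 1 / fact i" if "i \<ge> 1" for i
    using le[OF that] by (intro divide_left_mono fact_mono) auto
  have G: "geom_bounded (1 / x) G"
    unfolding G_def x_def by (rule taboo_weight_geom_bounded[OF assms \<phi>]) auto
  have F: "geom_bounded (1 / x) F"
    unfolding F_def x_def
    by (intro geom_bounded_X_mult taboo_weight_geom_bounded[OF assms \<psi>]) auto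
  have F_nth: "F $ n = (if n = 0 then 0 else taboo_weight b ?\<psi> b (n - 1))" for n
    by (simp add: F_def)
  have F_nonneg: "F $ n \<ge> 0" for n using taboo_weight_nonneg[of ?\<psi> b b "n - 1"] by (simp add: F_nth)
  have F1: "F $ 1 * x \<ge> 1" by (simp add: F_nth taboo_weight_0 x_def)
  \<comment> \<open>A level with two internal nodes followed by one with a single internal node
    contributes to \<open>F $ 3\<close>. The coefficient \<open>F $ 2\<close> is an empty sum, so
    the strict excess over 1 has to come from here.\<close>
  have "taboo_weight b ?\<psi> b 2 > 0" using assms by (simp add: taboo_weight_Suc taboo_weight_0 leaf_weight_def)
  then have F3: "F $ 3 > 0" by (simp add: F_nth)
  have Y: "Y = G + F * Y"
  proof (rule fps_ext)
    fix n
    have "(F * Y) $ n = (\<Sum>k=0..n. F $ k * comp_weight b b (n - k))" by (simp add: fps_mult_nth Y_def)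
    also have "\<dots> = (\<Sum>k=1..n. taboo_weight b ?\<psi> b (k - 1) * comp_weight b b (n - k))"
      by (rule sum.mono_neutral_cong_right) (auto simp: F_nth)
    finally show "Y $ n = (G + F * Y) $ n"
      using comp_weight_renewal[OF assms, of b n] assms by (simp add: Y_def G_def)
  qed
  show ?thesis
    unfolding q_egf_eq[OF assms] Y_def[symmetric]
    by (rule renewal_power_asymptotics[OF x F F_nonneg _ F1 F3 G _ _ Y])
      (auto simp: F_nth G_def taboo_weight_0 intro: taboo_weight_nonneg)
qed

section \<open>From absolute to relative error\<close>

text \<open>Since the leading coefficient is positive, the polynomial is eventually at least that
  coefficient, so dividing by it keeps the error of order \<open>\<kappa> ^ n\<close>.\<close>

lemma relative_error:
  fixes P :: "real poly" and a :: "nat \<Rightarrow> real"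
  assumes "lead_coeff P > 0" "\<rho> > 0" "\<kappa> > 0"
    and a: "\<And>n. \<bar>\<rho> ^ n * a n - poly P (real n)\<bar> \<le> C * \<kappa> ^ n"
  shows "\<exists>\<epsilon> \<in> O(\<lambda>n. \<kappa> ^ n). \<forall>\<^sub>F n in sequentially. a n = poly P (real n) * (1 / \<rho>) ^ n * (1 + \<epsilon> n)"
proof -
  obtain x0 where x0: "\<And>x. x \<ge> x0 \<Longrightarrow> poly P x \<ge> lead_coeff P"
    using poly_pinfty_gt_lc[OF assms(1)] by blast
  have ev: "\<forall>\<^sub>F n in sequentially. poly P (real n) \<ge> lead_coeff P"
    using eventually_ge_at_top[of "nat \<lceil>x0\<rceil>"]
    by eventually_elim (intro x0, linarith)
  define \<epsilon> where "\<epsilon> = (\<lambda>n. (\<rho> ^ n * a n - poly P (real n)) / poly P (real n))"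
  have "\<epsilon> \<in> O(\<lambda>n. \<kappa> ^ n)"
  proof (rule bigoI[where c = "C / lead_coeff P"])
    show "\<forall>\<^sub>F n in sequentially. norm (\<epsilon> n) \<le> C / lead_coeff P * norm (\<kappa> ^ n)"
      using ev
    proof eventually_elim
      case (elim n)
      have "norm (\<epsilon> n) = \<bar>\<rho> ^ n * a n - poly P (real n)\<bar> / poly P (real n)"
        using elim assms(1) by (simp add: \<epsilon>_def)
      also have "\<dots> \<le> (C * \<kappa> ^ n) / lead_coeff P"
        using elim assms(1) a[of n] order_trans[OF abs_ge_zero a[of n]]
        by (intro frac_le) auto
      finally show ?case using assms(3) by simp
    qed
  qed
  moreover have "\<forall>\<^sub>F n in sequentially. a n = poly P (real n) * (1 / \<rho>) ^ n * (1 + \<epsilon> n)"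
    using ev
  proof eventually_elim
    case (elim n)
    then have "poly P (real n) \<noteq> 0" using assms(1) by linarith
    then have "poly P (real n) * (1 + \<epsilon> n) = \<rho> ^ n * a n"
      by (simp add: \<epsilon>_def field_simps)
    then have "(1 / \<rho>) ^ n * (poly P (real n) * (1 + \<epsilon> n)) = (1 / \<rho>) ^ n * (\<rho> ^ n * a n)" by simp
    also have "\<dots> = a n" using assms(2) by (simp add: power_divide)
    finally show ?case by (simp only: mult_ac)
  qed
  ultimately show ?thesis by blast
qed

theorem theorem3:
  fixes b :: nat
  assumes "b \<ge> 2"
  shows "\<exists>\<alpha> \<gamma> \<kappa> :: real. \<alpha> > 0 \<and> \<gamma> > 0 \<and> 0 < \<kappa> \<and> \<kappa> < 1 \<and>
    (\<forall>m. W b 1 ((b - 1) * m + 1) = q b m) \<and>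
    (\<exists>\<epsilon> :: nat \<Rightarrow> real. \<epsilon> \<in> O(\<lambda>m. \<kappa> ^ m) \<and>
      (\<forall>\<^sub>F m in sequentially.
        real (q b m) / fact ((b - 1) * m + 1) = \<alpha> * \<gamma> ^ m * (1 + \<epsilon> m))) \<and>
    (\<forall>s\<ge>1. \<exists>P :: real poly.
      degree P = s - 1 \<and> lead_coeff P = \<alpha> ^ s / fact (s - 1) \<and>
      (\<exists>\<epsilon> :: nat \<Rightarrow> real. \<epsilon> \<in> O(\<lambda>m. \<kappa> ^ m) \<and>
        (\<forall>\<^sub>F m in sequentially.
          real (W b s ((b - 1) * m + s)) / fact ((b - 1) * m + s)
            = poly P (real m) * \<gamma> ^ m * (1 + \<epsilon> m))))"
proof -
  obtain \<alpha> \<rho> \<kappa> where pos: "\<alpha> > 0" "\<rho> > 0" "0 < \<kappa>" "\<kappa> < 1"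
    and asymp: "\<And>s. \<exists>P C. degree P = s \<and> lead_coeff P = \<alpha> ^ Suc s / fact s \<and>
      (\<forall>n. \<bar>\<rho> ^ n * (q_egf b ^ Suc s) $ n - poly P (real n)\<bar> \<le> C * \<kappa> ^ n)"
    using q_egf_power_asymptotics[OF assms] by blast
  have general: "\<exists>P :: real poly. degree P = s - 1 \<and> lead_coeff P = \<alpha> ^ s / fact (s - 1) \<and>
      (\<exists>\<epsilon> \<in> O(\<lambda>m. \<kappa> ^ m). \<forall>\<^sub>F m in sequentially.
          real (W b s ((b - 1) * m + s)) / fact ((b - 1) * m + s)
            = poly P (real m) * (1 / \<rho>) ^ m * (1 + \<epsilon> m))" if s: "s \<ge> 1" for s
  proof -
    have Suc: "Suc (s - 1) = s" using s by simp
    obtain P C where P: "degree P = s - 1" "lead_coeff P = \<alpha> ^ s / fact (s - 1)"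
      "\<And>n. \<bar>\<rho> ^ n * (q_egf b ^ s) $ n - poly P (real n)\<bar> \<le> C * \<kappa> ^ n"
      using asymp[of "s - 1"] unfolding Suc by blast
    have "lead_coeff P > 0" using P(2) pos(1) by simp
    then show ?thesis
      using relative_error[OF _ pos(2,3) P(3)] P(1,2) unfolding W_eq_q_egf_power[OF assms s] by blast
  qed
  obtain P :: "real poly" and \<epsilon> where P: "degree P = 1 - 1" "lead_coeff P = \<alpha> ^ 1 / fact (1 - 1)"
    and \<epsilon>: "\<epsilon> \<in> O(\<lambda>m. \<kappa> ^ m)" "\<forall>\<^sub>F m in sequentially.
          real (W b 1 ((b - 1) * m + 1)) / fact ((b - 1) * m + 1)
            = poly P (real m) * (1 / \<rho>) ^ m * (1 + \<epsilon> m)"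
    using general[of 1] by blast
  \<comment> \<open>For \<open>s = 1\<close> the degree is 0, so the polynomial is constant and
    equal to its leading coefficient.\<close>
  have "poly P x = \<alpha>" for x
    using P by (auto elim!: degree_eq_zeroE)
  then have "\<forall>\<^sub>F m in sequentially.
        real (q b m) / fact ((b - 1) * m + 1) = \<alpha> * (1 / \<rho>) ^ m * (1 + \<epsilon> m)"
    using \<epsilon>(2) unfolding W_1_eq_q[OF assms] by simp
  then show ?thesis
    using pos \<epsilon>(1) general W_1_eq_q[OF assms]
    by (intro exI[of _ \<alpha>] exI[of _ "1 / \<rho>"] exI[of _ \<kappa>] conjI) (auto simp: Bex_def)
qed

end
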